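(* Let $k$ and $\alpha$ be positive integers. Let $F$ be an $\alpha$-intersecting $k$-CNF formula. If $F$ has fewer than $$L_i = \frac{1}{2\alpha} \left(\frac{2^{(k-\alpha)}}{ek}-1\right)^{(2+1/\alpha)}$$ clause intersection pairs, or fewer than $$L_n = \left(\frac{2^{(k-\alpha)}}{ek}\right)^{1/\alpha}$$ variables, or fewer than $$L_m = \frac{1}{k} \left(\frac{2^{(k-\alpha)}}{ek}\right)^{1+1/\alpha}$$ clauses, then $F$ is satisfiable, and moreover a satisfying assignment of $F$ can be found efficiently (in polynomial time).
   Context: A $k$-CNF formula is a conjunction of clauses, each clause being a disjunction of exactly $k$ literals over $k$ distinct Boolean variables (a literal is a variable or its negation); the same set of variables may underlie several clauses. The number of variables of $F$ is the number of distinct variables occurring in $F$. A $k$-CNF formula is $\alpha$-intersecting if any two distinct clauses share at most $\alpha$ variables. A clause intersection pair is an unordered pair of distinct clauses that share at least one variable. Here $e$ is Euler's number. *)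

theory Defs
  imports Complex_Main "HOL-Computational_Algebra.Polynomial"
begin

section \<open>CNF formulas\<close>

datatype literal = Pos nat | Neg nat

primrec var :: "literal \<Rightarrow> nat" where
  "var (Pos x) = x"
| "var (Neg x) = x"

type_synonym clause = "literal set"
type_synonym cnf = "clause set"
type_synonym assignment = "nat \<Rightarrow> bool"

definition clause_vars :: "clause \<Rightarrow> nat set" where
  "clause_vars C = var ` C"

definition vars :: "cnf \<Rightarrow> nat set" where
  "vars F = (\<Union>C\<in>F. clause_vars C)"

definition k_cnf :: "nat \<Rightarrow> cnf \<Rightarrow> bool" where
  "k_cnf k F \<longleftrightarrow> finite F \<and> (\<forall>C\<in>F. finite C \<and> card C = k \<and> inj_on var C)"

definition intersecting :: "nat \<Rightarrow> cnf \<Rightarrow> bool" where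
  "intersecting \<alpha> F \<longleftrightarrow>
     (\<forall>C\<in>F. \<forall>D\<in>F. C \<noteq> D \<longrightarrow> card (clause_vars C \<inter> clause_vars D) \<le> \<alpha>)"

definition intersection_pairs :: "cnf \<Rightarrow> clause set set" where
  "intersection_pairs F =
     {{C, D} | C D. C \<in> F \<and> D \<in> F \<and> C \<noteq> D \<and> clause_vars C \<inter> clause_vars D \<noteq> {}}"

primrec lit_holds :: "assignment \<Rightarrow> literal \<Rightarrow> bool" where
  "lit_holds a (Pos x) \<longleftrightarrow> a x"
| "lit_holds a (Neg x) \<longleftrightarrow> \<not> a x"

definition satisfies :: "assignment \<Rightarrow> cnf \<Rightarrow> bool" where
  "satisfies a F \<longleftrightarrow> (\<forall>C\<in>F. \<exists>l\<in>C. lit_holds a l)"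

definition satisfiable :: "cnf \<Rightarrow> bool" where
  "satisfiable F \<longleftrightarrow> (\<exists>a. satisfies a F)"

section \<open>The three bounds\<close>

definition bound_base :: "nat \<Rightarrow> nat \<Rightarrow> real" where
  "bound_base k \<alpha> = 2 powr (real k - real \<alpha>) / (exp 1 * real k)"

text \<open>
  If \<open>bound_base k \<alpha> < 1\<close>, the power in \<open>L_i\<close> has a negative base.  On reals, \<^const>\<open>powr\<close>
  then uses the absolute value of the base, which is below 1, so that \<open>L_i k \<alpha> < 1\<close> and the
  condition of having fewer than \<open>L_i k \<alpha>\<close> intersection pairs says that there are none.
\<close>

definition L_i :: "nat \<Rightarrow> nat \<Rightarrow> real" where
  "L_i k \<alpha> = 1 / (2 * real \<alpha>) * (bound_base k \<alpha> - 1) powr (2 + 1 / real \<alpha>)"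

definition L_n :: "nat \<Rightarrow> nat \<Rightarrow> real" where
  "L_n k \<alpha> = bound_base k \<alpha> powr (1 / real \<alpha>)"

definition L_m :: "nat \<Rightarrow> nat \<Rightarrow> real" where
  "L_m k \<alpha> = 1 / real k * bound_base k \<alpha> powr (1 + 1 / real \<alpha>)"

definition small_intersecting :: "nat \<Rightarrow> nat \<Rightarrow> cnf \<Rightarrow> bool" where
  "small_intersecting k \<alpha> F \<longleftrightarrow>
     k_cnf k F \<and> intersecting \<alpha> F \<and>
     (real (card (intersection_pairs F)) < L_i k \<alpha> \<or>
      real (card (vars F)) < L_n k \<alpha> \<or>
      real (card F) < L_m k \<alpha>)"

section \<open>A machine model with unit-cost steps\<close>

text \<open>
  A first-order call-by-value language over binary trees (Lisp cells with a single atom), in the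
  style of Jones, ``Computability and Complexity from a Programming Perspective''.
  Every construct takes one step.  The only primitives are building a cell, taking one
  apart, and testing for the atom, so a run of \<open>t\<close> steps allocates at most \<open>t\<close> cells (as
  a shared graph) and the model is polynomially equivalent to Turing machines.
  A program is a list of function bodies; the first one is the entry point.  Variables are
  de Bruijn indices into the environment, which \<open>LetE\<close> extends at the front.
\<close>

datatype tree = Atom | Cell tree tree

primrec left :: "tree \<Rightarrow> tree" where
  "left Atom = Atom"
| "left (Cell u v) = u"

primrec right :: "tree \<Rightarrow> tree" where
  "right Atom = Atom"
| "right (Cell u v) = v"

datatype expr =
    VarE nat
  | AtomE
  | CellE expr expr
  | LeftE expr
  | RightE expr
  | IfE expr expr expr
  | LetE expr expr
  | CallE nat "expr list"

type_synonym program = "expr list"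

text \<open>\<open>eval P \<rho> e v t\<close>: in the environment \<open>\<rho>\<close>, the expression \<open>e\<close> evaluates to \<open>v\<close> in \<open>t\<close> steps.\<close>

inductive eval :: "program \<Rightarrow> tree list \<Rightarrow> expr \<Rightarrow> tree \<Rightarrow> nat \<Rightarrow> bool"
  and evals :: "program \<Rightarrow> tree list \<Rightarrow> expr list \<Rightarrow> tree list \<Rightarrow> nat \<Rightarrow> bool"
  for P :: program
where
  eval_Var: "i < length \<rho> \<Longrightarrow> eval P \<rho> (VarE i) (\<rho> ! i) 1"
| eval_Atom: "eval P \<rho> AtomE Atom 1"
| eval_Cell: "eval P \<rho> e u s \<Longrightarrow> eval P \<rho> f v t \<Longrightarrow> eval P \<rho> (CellE e f) (Cell u v) (s + t + 1)"
| eval_Left: "eval P \<rho> e v t \<Longrightarrow> eval P \<rho> (LeftE e) (left v) (t + 1)"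
| eval_Right: "eval P \<rho> e v t \<Longrightarrow> eval P \<rho> (RightE e) (right v) (t + 1)"
| eval_If_Cell: "eval P \<rho> c b s \<Longrightarrow> b \<noteq> Atom \<Longrightarrow> eval P \<rho> e v t \<Longrightarrow>
    eval P \<rho> (IfE c e f) v (s + t + 1)"
| eval_If_Atom: "eval P \<rho> c Atom s \<Longrightarrow> eval P \<rho> f v t \<Longrightarrow>
    eval P \<rho> (IfE c e f) v (s + t + 1)"
| eval_Let: "eval P \<rho> e u s \<Longrightarrow> eval P (u # \<rho>) f v t \<Longrightarrow> eval P \<rho> (LetE e f) v (s + t + 1)"
| eval_Call: "evals P \<rho> es us s \<Longrightarrow> i < length P \<Longrightarrow> eval P us (P ! i) v t \<Longrightarrow>
    eval P \<rho> (CallE i es) v (s + t + 1)"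
| evals_Nil: "evals P \<rho> [] [] 0"
| evals_Cons: "eval P \<rho> e u s \<Longrightarrow> evals P \<rho> es us t \<Longrightarrow> evals P \<rho> (e # es) (u # us) (s + t)"

inductive_cases eval_elims:
  "eval P \<rho> (VarE i) v t" "eval P \<rho> AtomE v t" "eval P \<rho> (CellE e f) v t"
  "eval P \<rho> (LeftE e) v t" "eval P \<rho> (RightE e) v t" "eval P \<rho> (IfE c e f) v t"
  "eval P \<rho> (LetE e f) v t" "eval P \<rho> (CallE i es) v t"
  "evals P \<rho> [] vs t" "evals P \<rho> (e # es) vs t"

lemma eval_deterministic_aux:
  "eval P \<rho> e v t \<Longrightarrow> (\<And>v' t'. eval P \<rho> e v' t' \<Longrightarrow> v = v' \<and> t = t')"
  "evals P \<rho> es vs t \<Longrightarrow> (\<And>vs' t'. evals P \<rho> es vs' t' \<Longrightarrow> vs = vs' \<and> t = t')"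
proof (induction rule: eval_evals.inducts)
  case (eval_Var i \<rho>)
  from eval_Var.prems show ?case by (rule eval_elims) simp
next
  case (eval_Atom \<rho>)
  from eval_Atom.prems show ?case by (rule eval_elims) simp
next
  case (eval_Cell \<rho> e u s f v t)
  from eval_Cell.prems show ?case
    by (rule eval_elims(3)) (metis eval_Cell.IH Suc_eq_plus1)
next
  case (eval_Left \<rho> e v t)
  from eval_Left.prems show ?case
    by (rule eval_elims(4)) (metis eval_Left.IH Suc_eq_plus1)
next
  case (eval_Right \<rho> e v t)
  from eval_Right.prems show ?case
    by (rule eval_elims(5)) (metis eval_Right.IH Suc_eq_plus1)
next
  case (eval_If_Cell \<rho> c b s e v t f)
  from eval_If_Cell.prems show ?case
    by (rule eval_elims(6)) (metis eval_If_Cell.IH Suc_eq_plus1 eval_If_Cell.hyps)+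
next
  case (eval_If_Atom \<rho> c s f v t e)
  from eval_If_Atom.prems show ?case
    by (rule eval_elims(6)) (metis eval_If_Atom.IH Suc_eq_plus1)+
next
  case (eval_Let \<rho> e u s f v t)
  from eval_Let.prems show ?case
    by (rule eval_elims(7)) (metis eval_Let.IH Suc_eq_plus1)
next
  case (eval_Call \<rho> es us s i v t)
  from eval_Call.prems show ?case
    by (rule eval_elims(8)) (metis eval_Call.IH Suc_eq_plus1)
next
  case (evals_Nil \<rho>)
  from evals_Nil.prems show ?case by (rule eval_elims) simp
next
  case (evals_Cons \<rho> e u s es us t)
  from evals_Cons.prems show ?case
    by (rule eval_elims(10)) (metis evals_Cons.IH)
qed

lemma eval_deterministic:
  "eval P \<rho> e v t \<Longrightarrow> eval P \<rho> e v' t' \<Longrightarrow> v' = v \<and> t' = t"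
  using eval_deterministic_aux by blast

definition runs :: "program \<Rightarrow> tree list \<Rightarrow> tree \<Rightarrow> nat \<Rightarrow> bool" where
  "runs P ins out t \<longleftrightarrow> P \<noteq> [] \<and> eval P ins (hd P) out t"

section \<open>Encodings\<close>

fun bits :: "nat \<Rightarrow> bool list" where
  "bits n = (if n = 0 then [] else odd n # bits (n div 2))"

declare bits.simps [simp del]

primrec enc_list :: "('a \<Rightarrow> tree) \<Rightarrow> 'a list \<Rightarrow> tree" where
  "enc_list f [] = Atom"
| "enc_list f (x # xs) = Cell (f x) (enc_list f xs)"

definition enc_bool :: "bool \<Rightarrow> tree" where
  "enc_bool b = (if b then Cell Atom Atom else Atom)"

definition enc_nat :: "nat \<Rightarrow> tree" where
  "enc_nat n = enc_list enc_bool (bits n)"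

primrec enc_literal :: "literal \<Rightarrow> tree" where
  "enc_literal (Pos x) = Cell (enc_bool True) (enc_nat x)"
| "enc_literal (Neg x) = Cell (enc_bool False) (enc_nat x)"

definition enc_cnf :: "literal list list \<Rightarrow> tree" where
  "enc_cnf = enc_list (enc_list enc_literal)"

definition enc_var_list :: "nat list \<Rightarrow> tree" where
  "enc_var_list = enc_list enc_nat"

text \<open>
  Formulas are sets, machines read lists: an algorithm has to cope with every order in which
  clauses and literals may be listed.
\<close>

definition lists_cnf :: "literal list list \<Rightarrow> cnf \<Rightarrow> bool" where
  "lists_cnf cs F \<longleftrightarrow>
     set (map set cs) = F \<and> distinct (map set cs) \<and> (\<forall>c\<in>set cs. distinct c)"

text \<open>The number of cells; up to a constant factor, the bit length of a binary encoding.\<close>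

definition input_size :: "literal list list \<Rightarrow> nat" where
  "input_size cs = size (enc_cnf cs)"

section \<open>Finding satisfying assignments in polynomial time\<close>

text \<open>An output lists the variables that are set to true.\<close>

definition assignment_of :: "nat list \<Rightarrow> assignment" where
  "assignment_of xs = (\<lambda>x. x \<in> set xs)"

definition poly_time_satisfying :: "cnf set \<Rightarrow> bool" where
  "poly_time_satisfying \<F> \<longleftrightarrow>
     (\<exists>(P :: program) (p :: nat poly). \<forall>F\<in>\<F>. \<forall>cs. lists_cnf cs F \<longrightarrow>
        (\<exists>xs t. runs P [enc_cnf cs] (enc_var_list xs) t \<and>
                t \<le> poly p (input_size cs) \<and>
                satisfies (assignment_of xs) F))"

text \<open>
  Zero-error randomised version: the second input is a string of polynomially many independent fair
  coin flips.  Every run is polynomially bounded and returns either a satisfying assignment, tagged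
  by a cell, or \<^const>\<open>Atom\<close> for failure; at most half of the strings lead to failure.
  (Repetition until success turns this into expected polynomial time without failure.)
\<close>

definition rand_poly_time_satisfying :: "cnf set \<Rightarrow> bool" where
  "rand_poly_time_satisfying \<F> \<longleftrightarrow>
     (\<exists>(P :: program) (p :: nat poly) (q :: nat poly). \<forall>F\<in>\<F>. \<forall>cs. lists_cnf cs F \<longrightarrow>
        (let R = {r :: bool list. length r = poly q (input_size cs)};
             run = (\<lambda>r. runs P [enc_cnf cs, enc_list enc_bool r])
         in (\<forall>r\<in>R. \<exists>out t. run r out t \<and> t \<le> poly p (input_size cs) \<and>
               (out = Atom \<or>
                (\<exists>xs. out = Cell Atom (enc_var_list xs) \<and> satisfies (assignment_of xs) F))) \<and>
            2 * card {r \<in> R. \<exists>t. run r Atom t} \<le> card R))"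

end

theory Submission
  imports Defs
begin

text \<open>
  Put \<open>D = bound_base k \<alpha>\<close>.  If \<open>D < 1\<close>, the hypotheses force the clauses to have disjoint
  variables, and making the first literal of every clause true satisfies the formula.  If
  \<open>D \<ge> 1\<close>, remove from every clause its \<open>\<alpha>\<close> most frequent variables.  A variable that still occurs
  in more than \<open>D\<close> truncated clauses meets more than \<open>D\<close> removed \<open>\<alpha>\<close>-sets, which are distinct by
  \<open>\<alpha>\<close>-intersection and consist of variables of degree more than \<open>D\<close>; hence there are at least
  \<open>D powr (1 / \<alpha>)\<close> variables of such degree, and too many pairs, variables and clauses.

  So the truncated formula satisfies the condition of the local lemma, with a factor \<open>1 - 1 / k\<close>
  to spare.  Always resample the first violated truncated clause.  The log of resampled clauses and
  the final assignment determine all coins used, and the log itself can be encoded cheaply, as the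
  clauses that become pending in a step are neighbours of the resampled clause.  Counting logs bounds
  the number of coin strings that lead to failure.  As \<open>\<alpha>\<close> is not part of the input, the randomised
  program tries every number of removed variables.

  For fixed \<open>k\<close> and \<open>\<alpha>\<close> the clauses that meet another clause have boundedly many variables, and
  the initial assignment satisfies all other clauses.  Some satisfying assignment is
  therefore at bounded Hamming distance, and a local search of bounded depth finds one.
\<close>

section \<open>Variables of large degree\<close>

text \<open>At the exact threshold of the local lemma, counting logs gives no decay in the number of
  steps; hence the slack is essential. It arises because a truncated clause has only
  \<open>k - \<alpha>\<close> \<le> \<open>k - 1\<close> literals, while \<open>bound_base\<close>
  divides by \<open>k\<close>. About \<open>k\<close> resampling steps then save one bit, and
  \<open>k\<close> times (clauses + variables + 1) steps pay for the unknown initial pending set,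
  the unknown final assignment and one further bit, the failure probability 1/2. The same count
  proves satisfiability, since a coin string that does not fail exhibits an assignment. The
  deterministic part takes only this existence from it; its search depth depends on \<open>k\<close>
  and \<open>\<alpha>\<close> and is built into the program. The randomised program has to be
  independent of both. This works because an assignment found for any truncation satisfies the full
  formula, and because the program fails only if all truncations fail with the same coins, so that
  an analysis of the truncation by \<open>\<alpha>\<close> alone suffices.\<close>

definition occurrences :: "cnf \<Rightarrow> nat \<Rightarrow> cnf" where
  "occurrences F x = {C \<in> F. x \<in> clause_vars C}"

lemma sum_card_filter_swap:
  assumes "finite A" "finite B"
  shows "(\<Sum>x\<in>A. card {y \<in> B. R x y}) = (\<Sum>y\<in>B. card {x \<in> A. R x y})"
proof -
  have "card {y \<in> B. R x y} = (\<Sum>y\<in>B. if R x y then 1 else 0)" for x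
    using assms(2) by (simp add: sum.If_cases Int_def)
  moreover have "card {x \<in> A. R x y} = (\<Sum>x\<in>A. if R x y then 1 else 0)" for y
    using assms(1) by (simp add: sum.If_cases Int_def)
  ultimately show ?thesis by (simp only: sum.swap[of _ B A])
qed

lemma k_cnf_clause_vars:
  assumes "k_cnf k F" "C \<in> F"
  shows "finite (clause_vars C)" "card (clause_vars C) = k"
  using assms by (auto simp: k_cnf_def clause_vars_def card_image)

lemma finite_vars: "k_cnf k F \<Longrightarrow> finite (vars F)"
  using k_cnf_clause_vars by (auto simp: vars_def k_cnf_def)

lemma finite_intersection_pairs: "finite F \<Longrightarrow> finite (intersection_pairs F)"
  by (rule finite_subset[of _ "Pow F"]) (auto simp: intersection_pairs_def)

lemma sum_degrees:
  assumes F: "k_cnf k F"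
  shows "(\<Sum>x\<in>vars F. card (occurrences F x)) = k * card F"
proof -
  have "(\<Sum>x\<in>vars F. card (occurrences F x)) = (\<Sum>C\<in>F. card {x \<in> vars F. x \<in> clause_vars C})"
    unfolding occurrences_def
    using F finite_vars[OF F] by (intro sum_card_filter_swap) (auto simp: k_cnf_def)
  also have "\<dots> = (\<Sum>C\<in>F. k)"
  proof (rule sum.cong[OF refl])
    fix C assume C: "C \<in> F"
    then have "{x \<in> vars F. x \<in> clause_vars C} = clause_vars C" by (auto simp: vars_def)
    then show "card {x \<in> vars F. x \<in> clause_vars C} = k" using k_cnf_clause_vars[OF F C] by simp
  qed
  finally show ?thesis by simp
qed

text \<open>Double counting of a variable of \<open>H\<close> together with two clauses that contain
  it: any two clauses arise from at most \<open>\<alpha>\<close> variables.\<close>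

lemma sum_degree_choose_2:
  assumes F: "k_cnf k F" "intersecting \<alpha> F" and H: "finite H"
  shows "(\<Sum>x\<in>H. card (occurrences F x) choose 2) \<le> \<alpha> * card (intersection_pairs F)"
proof -
  have fin: "finite F" using F by (simp add: k_cnf_def)
  have "(\<Sum>x\<in>H. card (occurrences F x) choose 2)
      = (\<Sum>x\<in>H. card {p \<in> intersection_pairs F. p \<subseteq> occurrences F x})"
  proof (rule sum.cong[OF refl])
    fix x
    have "{p \<in> intersection_pairs F. p \<subseteq> occurrences F x}
        = {p. p \<subseteq> occurrences F x \<and> card p = 2}"
      by (auto simp: intersection_pairs_def occurrences_def card_2_iff)
    then show "card (occurrences F x) choose 2
        = card {p \<in> intersection_pairs F. p \<subseteq> occurrences F x}"
      using fin n_subsets[of "occurrences F x" 2] by (simp add: occurrences_def)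
  qed
  also have "\<dots> = (\<Sum>p\<in>intersection_pairs F. card {x \<in> H. p \<subseteq> occurrences F x})"
    using H finite_intersection_pairs[OF fin] by (rule sum_card_filter_swap)
  also have "\<dots> \<le> (\<Sum>p\<in>intersection_pairs F. \<alpha>)"
  proof (rule sum_mono)
    fix p assume "p \<in> intersection_pairs F"
    then obtain C D where p: "p = {C, D}" "C \<in> F" "D \<in> F" "C \<noteq> D"
      by (auto simp: intersection_pairs_def)
    have "card {x \<in> H. p \<subseteq> occurrences F x} \<le> card (clause_vars C \<inter> clause_vars D)"
      using p k_cnf_clause_vars[OF F(1)] by (intro card_mono) (auto simp: occurrences_def)
    also have "\<dots> \<le> \<alpha>" using F(2) p by (auto simp: intersecting_def)
    finally show "card {x \<in> H. p \<subseteq> occurrences F x} \<le> \<alpha>" .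
  qed
  finally show ?thesis by (simp add: mult.commute)
qed

lemma binomial_le_power: "n choose r \<le> n ^ r"
  by (cases "r \<le> n") (simp_all add: binomial_le_pow binomial_eq_0)

lemma many_large_degrees:
  assumes F: "k_cnf k F" "intersecting \<alpha> F"
    and S: "\<And>C. C \<in> F \<Longrightarrow> S C \<subseteq> clause_vars C \<and> card (S C) = \<alpha>"
    and A: "\<And>C. C \<in> A \<Longrightarrow> C \<in> F \<and> x \<in> clause_vars C - S C"
    and max: "\<And>C y. C \<in> A \<Longrightarrow> y \<in> S C \<Longrightarrow> card A \<le> card (occurrences F y)"
  shows "card A \<le> card {y \<in> vars F. card A \<le> card (occurrences F y)} ^ \<alpha>"
proof -
  let ?H = "{y \<in> vars F. card A \<le> card (occurrences F y)}"
  have fin: "finite ?H" using finite_vars[OF F(1)] by simp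
  have "inj_on S A"
  proof (rule inj_onI, rule ccontr)
    fix C D assume CD: "C \<in> A" "D \<in> A" "S C = S D" "C \<noteq> D"
    \<comment> \<open>The variable \<open>x\<close> outside the removed sets is what turns equal
      sets into \<open>\<alpha> + 1\<close> common variables.\<close>
    have "insert x (S C) \<subseteq> clause_vars C \<inter> clause_vars D"
      using CD A[OF CD(1)] A[OF CD(2)] S[of C] S[of D] by auto
    then have "card (insert x (S C)) \<le> card (clause_vars C \<inter> clause_vars D)"
      using k_cnf_clause_vars[OF F(1)] A[OF CD(1)] by (intro card_mono) auto
    also have "\<dots> \<le> \<alpha>" using F(2) A CD by (auto simp: intersecting_def)
    finally have "card (insert x (S C)) \<le> \<alpha>" .
    moreover have "finite (S C)"
      using A[OF CD(1)] S[of C] k_cnf_clause_vars[OF F(1)] finite_subset by blast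
    ultimately show False using A[OF CD(1)] S[of C] by simp
  qed
  then have "card A = card (S ` A)" by (simp add: card_image)
  also have "\<dots> \<le> card {B. B \<subseteq> ?H \<and> card B = \<alpha>}"
  proof (rule card_mono)
    show "finite {B. B \<subseteq> ?H \<and> card B = \<alpha>}" using fin by simp
    show "S ` A \<subseteq> {B. B \<subseteq> ?H \<and> card B = \<alpha>}"
    proof
      fix B assume "B \<in> S ` A"
      then obtain C where C: "C \<in> A" "B = S C" by auto
      then show "B \<in> {B. B \<subseteq> ?H \<and> card B = \<alpha>}"
        using A[OF C(1)] S[of C] max[OF C(1)] by (auto simp: vars_def)
    qed
  qed
  also have "\<dots> = card ?H choose \<alpha>" using n_subsets[OF fin] by simp
  also have "\<dots> \<le> card ?H ^ \<alpha>" by (rule binomial_le_power)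
  finally show ?thesis .
qed

text \<open>\<open>S C\<close> is the set of variables removed from \<open>C\<close>.\<close>

lemma truncated_degree_le:
  assumes pos: "k > 0" "\<alpha> > 0" and F: "small_intersecting k \<alpha> F"
    and base: "bound_base k \<alpha> \<ge> 1"
    and S: "\<And>C. C \<in> F \<Longrightarrow> S C \<subseteq> clause_vars C \<and> card (S C) = \<alpha>"
    and max: "\<And>C y z. C \<in> F \<Longrightarrow> y \<in> S C \<Longrightarrow> z \<in> clause_vars C - S C \<Longrightarrow>
      card (occurrences F z) \<le> card (occurrences F y)"
  shows "real (card {C \<in> F. x \<in> clause_vars C - S C}) \<le> bound_base k \<alpha>"
proof (rule ccontr)
  let ?D = "bound_base k \<alpha>"
  define A where "A = {C \<in> F. x \<in> clause_vars C - S C}"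
  define H where "H = {y \<in> vars F. card A \<le> card (occurrences F y)}"
  assume "\<not> ?thesis"
  then have big: "?D < real (card A)" by (simp add: A_def)
  have F': "k_cnf k F" "intersecting \<alpha> F" using F by (auto simp: small_intersecting_def)
  have finF: "finite F" using F' by (simp add: k_cnf_def)
  have finH: "finite H" using finite_vars[OF F'(1)] by (simp add: H_def)
  have le: "card A \<le> card (occurrences F x)"
    using finF by (intro card_mono) (auto simp: A_def occurrences_def)
  have "card A \<le> card H ^ \<alpha>"
    unfolding H_def using F' S
  proof (rule many_large_degrees)
    show "C \<in> F \<and> x \<in> clause_vars C - S C" if "C \<in> A" for C
      using that by (simp add: A_def)
    show "card A \<le> card (occurrences F y)" if "C \<in> A" "y \<in> S C" for C y
      using max[of C y x] that le by (auto simp: A_def)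
  qed
  then have "?D \<le> real (card H ^ \<alpha>)" using big by linarith
  also have "\<dots> = real (card H) powr real \<alpha>" using pos by (simp add: powr_realpow')
  finally have "?D powr (1 / real \<alpha>) \<le> (real (card H) powr real \<alpha>) powr (1 / real \<alpha>)"
    using base by (intro powr_mono2) auto
  then have h: "?D powr (1 / real \<alpha>) \<le> real (card H)" using pos by (simp add: powr_powr)
  from F consider
      "real (card (intersection_pairs F)) < L_i k \<alpha>"
    | "real (card (vars F)) < L_n k \<alpha>"
    | "real (card F) < L_m k \<alpha>"
    by (auto simp: small_intersecting_def)
  then show False
  proof cases
    case 1
    \<comment> \<open>The exponent splits: 2 stands for the pairs at one variable of
      \<open>H\<close>, at least \<open>(?D - 1) * ?D / 2\<close> many, and
      \<open>1 / \<alpha>\<close> for the number of variables in \<open>H\<close>.\<close>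
    have "(?D - 1) powr (2 + 1 / real \<alpha>) = (?D - 1) ^ 2 * (?D - 1) powr (1 / real \<alpha>)"
      using base by (simp add: powr_add powr_numeral)
    also have "\<dots> \<le> ((?D - 1) * ?D) * ?D powr (1 / real \<alpha>)"
      using base by (intro mult_mono powr_mono2) (auto simp: power2_eq_square intro!: mult_left_mono)
    also have "\<dots> \<le> ((?D - 1) * ?D) * real (card H)"
      using h base by (intro mult_left_mono) auto
    also have "\<dots> \<le> (\<Sum>y\<in>H. 2 * real (card (occurrences F y) choose 2))"
    proof -
      have "(\<Sum>y\<in>H. (?D - 1) * ?D) \<le> (\<Sum>y\<in>H. 2 * real (card (occurrences F y) choose 2))"
      proof (rule sum_mono)
        fix y assume "y \<in> H"
        then have y: "?D < real (card (occurrences F y))" using big by (simp add: H_def)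
        then have "(?D - 1) * ?D
            \<le> (real (card (occurrences F y)) - 1) * real (card (occurrences F y))"
          using base by (intro mult_mono) auto
        also have "\<dots> = 2 * real (card (occurrences F y) choose 2)"
        proof -
          have "2 * (m choose 2) = m * (m - 1)" for m :: nat
            by (cases m) (simp_all add: choose_two)
          then have "real (2 * (m choose 2)) = real (m * (m - 1))" for m :: nat
            by (rule arg_cong)
          then have "2 * real (m choose 2) = (real m - 1) * real m" if "m \<ge> 1" for m :: nat
            using that by (simp add: of_nat_diff mult.commute)
          then show ?thesis using y base by simp
        qed
        finally show "(?D - 1) * ?D \<le> 2 * real (card (occurrences F y) choose 2)" .
      qed
      then show ?thesis by (simp add: mult.commute)
    qed
    also have "\<dots> = 2 * real (\<Sum>y\<in>H. card (occurrences F y) choose 2)"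
      by (simp add: sum_distrib_left)
    also have "\<dots> \<le> 2 * real (\<alpha> * card (intersection_pairs F))"
      using sum_degree_choose_2[OF F' finH] by (intro mult_left_mono of_nat_mono) auto
    finally show False using 1 pos by (simp add: L_i_def field_simps)
  next
    case 2
    have "card H \<le> card (vars F)"
      using finite_vars[OF F'(1)] by (intro card_mono) (auto simp: H_def)
    then show False using 2 h by (simp add: L_n_def)
  next
    case 3
    \<comment> \<open>Here the degrees themselves are summed: each variable of \<open>H\<close>
      accounts for more than \<open>?D\<close> of the \<open>k * card F\<close> literal
      occurrences.\<close>
    have "?D powr (1 + 1 / real \<alpha>) = ?D powr (1 / real \<alpha>) * ?D"
      using base by (simp add: powr_add)
    also have "\<dots> \<le> real (card H) * ?D" using h base by (intro mult_right_mono) auto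
    also have "\<dots> \<le> real (card H) * real (card A)" using big by (intro mult_left_mono) auto
    also have "\<dots> = real (\<Sum>y\<in>H. card A)" by simp
    also have "\<dots> \<le> real (\<Sum>y\<in>H. card (occurrences F y))"
      by (intro of_nat_mono sum_mono) (simp add: H_def)
    also have "\<dots> \<le> real (\<Sum>y\<in>vars F. card (occurrences F y))"
      using finite_vars[OF F'(1)] by (intro of_nat_mono sum_mono2) (auto simp: H_def)
    also have "\<dots> = real k * real (card F)" using sum_degrees[OF F'(1)] by simp
    finally show False using 3 pos by (simp add: L_m_def field_simps)
  qed
qed

text \<open>As \<open>e\<close> \<ge> 2, the assumption yields \<open>2 * k\<close> \<le>
  \<open>2 powr (k - \<alpha>)\<close>, which is impossible for exponents at most 1. Truncated
  clauses thus keep at least two literals, which later gives \<open>G\<close> \<ge> 2.\<close>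

lemma bound_base_ge_1_imp:
  assumes "k > 0" "\<alpha> > 0" "bound_base k \<alpha> \<ge> 1"
  shows "\<alpha> + 2 \<le> k"
proof -
  have e: "exp (1 :: real) \<ge> 2" using exp_ge_add_one_self[of 1] by simp
  have "exp 1 * real k \<le> 2 powr (real k - real \<alpha>)"
    using assms by (simp add: bound_base_def field_simps)
  moreover have "2 * real k \<le> exp 1 * real k" using e by (intro mult_right_mono) auto
  ultimately have *: "2 * real k \<le> 2 powr (real k - real \<alpha>)" by linarith
  show ?thesis
  proof (rule ccontr)
    assume "\<not> \<alpha> + 2 \<le> k"
    then have "2 powr (real k - real \<alpha>) \<le> (2 :: real) powr 1" by (intro powr_mono) auto
    then have "real k \<le> 1" using * by simp
    then have "k = 1" using assms by simp
    then have "2 powr (real k - real \<alpha>) \<le> (2 :: real) powr 0" using assms by (intro powr_mono) auto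
    then show False using * \<open>k = 1\<close> by simp
  qed
qed

text \<open>All three bounds are at most 1 in this range, so the strict inequality makes the
  respective count 0.\<close>

lemma no_intersection_if_bound_base_less_1:
  assumes pos: "k > 0" "\<alpha> > 0" and F: "small_intersecting k \<alpha> F" and base: "bound_base k \<alpha> < 1"
  shows "intersection_pairs F = {}"
proof -
  let ?D = "bound_base k \<alpha>"
  have D: "?D > 0" using pos by (simp add: bound_base_def)
  have F': "k_cnf k F" using F by (simp add: small_intersecting_def)
  then have fin: "finite F" by (simp add: k_cnf_def)
  from F consider
      "real (card (intersection_pairs F)) < L_i k \<alpha>"
    | "real (card (vars F)) < L_n k \<alpha>"
    | "real (card F) < L_m k \<alpha>"
    by (auto simp: small_intersecting_def)
  then show ?thesis
  proof cases
    case 1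
    \<comment> \<open>The base is negative, and \<open>ln\<close> takes the same value at
      \<open>1 - ?D\<close>.\<close>
    have "(?D - 1) powr (2 + 1 / real \<alpha>) = (1 - ?D) powr (2 + 1 / real \<alpha>)"
      using ln_minus[of "1 - ?D"] base by (simp add: powr_def)
    also have "\<dots> \<le> 1 powr (2 + 1 / real \<alpha>)" using base D by (intro powr_mono2) auto
    finally have "L_i k \<alpha> \<le> 1 / (2 * real \<alpha>) * 1"
      unfolding L_i_def by (intro mult_left_mono) auto
    also have "\<dots> \<le> 1" using pos by (simp add: field_simps)
    finally have "card (intersection_pairs F) = 0" using 1 by linarith
    then show ?thesis using finite_intersection_pairs[OF fin] by simp
  next
    case 2
    have "L_n k \<alpha> \<le> 1 powr (1 / real \<alpha>)"
      unfolding L_n_def using base D by (intro powr_mono2) auto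
    then have "card (vars F) = 0" using 2 by simp
    then have "vars F = {}" using finite_vars[OF F'] by simp
    then show ?thesis by (auto simp: vars_def intersection_pairs_def)
  next
    case 3
    have "?D powr (1 + 1 / real \<alpha>) \<le> 1 powr (1 + 1 / real \<alpha>)"
      using base D by (intro powr_mono2) auto
    then have "L_m k \<alpha> \<le> 1 / real k * 1"
      unfolding L_m_def by (intro mult_left_mono) auto
    also have "\<dots> \<le> 1" using pos by (simp add: field_simps)
    finally have "card F = 0" using 3 by linarith
    then show ?thesis using fin by (simp add: intersection_pairs_def)
  qed
qed

section \<open>Logs of resampled clauses\<close>

text \<open>
  A clause is pending if it occurs in the log before any of its neighbours is resampled; it is then
  violated from the start, and so the first pending clause is the one that is resampled first.
\<close>

primrec pending :: "('c \<Rightarrow> 'c set) \<Rightarrow> 'c list \<Rightarrow> 'c set" where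
  "pending \<Gamma> [] = {}"
| "pending \<Gamma> (c # w) = insert c (pending \<Gamma> w - \<Gamma> c)"

text \<open>A condition on the log alone: no assignment occurs in it, yet the next clause is still a
  function of the current pending set. This is what makes logs easy to count.\<close>

primrec valid_log :: "('c \<Rightarrow> 'c set) \<Rightarrow> 'c list \<Rightarrow> 'c list \<Rightarrow> bool" where
  "valid_log \<Gamma> cs [] \<longleftrightarrow> True"
| "valid_log \<Gamma> cs (c # w) \<longleftrightarrow>
     find (\<lambda>d. d \<in> pending \<Gamma> (c # w)) cs = Some c \<and> valid_log \<Gamma> cs w"

definition logs :: "('c \<Rightarrow> 'c set) \<Rightarrow> 'c list \<Rightarrow> nat \<Rightarrow> 'c set \<Rightarrow> 'c list set" where
  "logs \<Gamma> cs n U = {w. length w = n \<and> valid_log \<Gamma> cs w \<and> pending \<Gamma> w = U}"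

lemma valid_log_subset: "valid_log \<Gamma> cs w \<Longrightarrow> set w \<subseteq> set cs"
  by (induction w) (auto simp: find_Some_iff)

lemma pending_subset: "pending \<Gamma> w \<subseteq> set w"
  by (induction w) auto

lemma finite_valid_logs: "finite {w. length w = n \<and> valid_log \<Gamma> cs w}"
  by (rule finite_subset[OF _ finite_lists_length_eq[of "set cs" n]])
    (use valid_log_subset in fastforce)+

lemma finite_logs: "finite (logs \<Gamma> cs n U)"
  by (rule finite_subset[OF _ finite_valid_logs[of n \<Gamma> cs]]) (auto simp: logs_def)

lemma sum_Pow_power:
  assumes "finite A"
  shows "(\<Sum>B\<in>Pow A. z ^ card B) = (1 + z :: real) ^ card A"
  using assms
proof (induction A)
  case (insert a A)
  have "(\<Sum>B\<in>Pow (insert a A). z ^ card B)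
      = (\<Sum>B\<in>Pow A. z ^ card B) + (\<Sum>B\<in>insert a ` Pow A. z ^ card B)"
    using insert.hyps by (subst Pow_insert, subst sum.union_disjoint) auto
  also have "(\<Sum>B\<in>insert a ` Pow A. z ^ card B) = (\<Sum>B\<in>Pow A. z ^ card (insert a B))"
    using insert.hyps by (subst sum.reindex) (auto intro!: inj_onI)
  also have "\<dots> = (\<Sum>B\<in>Pow A. z * z ^ card B)"
    using insert.hyps
    by (intro sum.cong refl) (metis PowD card_insert_disjoint finite_subset power_Suc subsetD)
  finally show ?case
    using insert by (simp add: sum_distrib_left[symmetric] algebra_simps)
qed simp

text \<open>The weight \<open>z ^ card U\<close> closes the recursion. \<open>U\<close> determines
  the first clause \<open>c\<close> of the log, and the rest of the log has pending set
  \<open>(U - {c}) \<union> B\<close> for some \<open>B\<close> \<subseteq>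
  \<open>\<Gamma> c\<close>. Summing \<open>z ^ card B\<close> over all \<open>B\<close> gives at
  most \<open>(1 + z) ^ g\<close>, and the removal of \<open>c\<close> costs a factor
  \<open>1 / z\<close>.\<close>

lemma card_logs:
  fixes z :: real
  assumes z: "z > 0"
    and \<Gamma>: "\<And>c. c \<in> set cs \<Longrightarrow> finite (\<Gamma> c) \<and> card (\<Gamma> c) \<le> g \<and> c \<in> \<Gamma> c"
  shows "real (card (logs \<Gamma> cs n U)) \<le> ((1 + z) ^ g / z) ^ n * z ^ card U"
proof (induction n arbitrary: U)
  case 0
  have "logs \<Gamma> cs 0 U = (if U = {} then {[]} else {})"
    by (auto simp: logs_def)
  then show ?case using z by auto
next
  case (Suc n)
  let ?l = "(1 + z) ^ g / z"
  show ?case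
  proof (cases "logs \<Gamma> cs (Suc n) U = {}")
    case True
    then show ?thesis using z by auto
  next
    case False
    then obtain v where v: "v \<in> logs \<Gamma> cs (Suc n) U" by blast
    then obtain c w where "v = c # w" by (auto simp: logs_def length_Suc_conv)
    with v have w: "c # w \<in> logs \<Gamma> cs (Suc n) U" by simp
    then have c: "find (\<lambda>d. d \<in> U) cs = Some c" and U: "U = insert c (pending \<Gamma> w - \<Gamma> c)"
      by (auto simp: logs_def)
    from c have "c \<in> set cs" by (auto simp: find_Some_iff)
    note \<Gamma>c = \<Gamma>[OF this]
    have "finite U"
      using U finite_subset[OF pending_subset] by auto
    \<comment> \<open>No clause of \<open>\<Gamma> c\<close> except \<open>c\<close> is pending in
      \<open>c # w\<close>. So every \<open>B\<close> is disjoint from \<open>U - {c}\<close> and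
      the cardinalities add up.\<close>
    have U': "U - \<Gamma> c = U - {c}" using U \<Gamma>c by auto
    have "c \<in> U" using U by auto
    have "logs \<Gamma> cs (Suc n) U
        \<subseteq> (#) c ` (\<Union>B\<in>Pow (\<Gamma> c). logs \<Gamma> cs n ((U - {c}) \<union> B))"
    proof
      fix v assume v: "v \<in> logs \<Gamma> cs (Suc n) U"
      then obtain c' v' where v': "v = c' # v'"
        by (auto simp: logs_def length_Suc_conv)
      with v c have "c' = c" by (auto simp: logs_def)
      moreover have "pending \<Gamma> v' = (U - {c}) \<union> (pending \<Gamma> v' \<inter> \<Gamma> c)"
        using v v' \<open>c' = c\<close> \<Gamma>c by (auto simp: logs_def)
      ultimately show "v \<in> (#) c ` (\<Union>B\<in>Pow (\<Gamma> c). logs \<Gamma> cs n ((U - {c}) \<union> B))"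
        using v v' by (auto simp: logs_def intro!: bexI[of _ "pending \<Gamma> v' \<inter> \<Gamma> c"])
    qed
    moreover have "finite (\<Union>B\<in>Pow (\<Gamma> c). logs \<Gamma> cs n ((U - {c}) \<union> B))"
      using \<Gamma>c finite_logs by blast
    ultimately have "card (logs \<Gamma> cs (Suc n) U)
        \<le> card (\<Union>B\<in>Pow (\<Gamma> c). logs \<Gamma> cs n ((U - {c}) \<union> B))"
      by (rule surj_card_le[rotated])
    also have "\<dots> \<le> (\<Sum>B\<in>Pow (\<Gamma> c). card (logs \<Gamma> cs n ((U - {c}) \<union> B)))"
      using \<Gamma>c by (intro card_UN_le) auto
    finally have "real (card (logs \<Gamma> cs (Suc n) U))
        \<le> real (\<Sum>B\<in>Pow (\<Gamma> c). card (logs \<Gamma> cs n ((U - {c}) \<union> B)))"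
      by (rule of_nat_mono)
    also have "\<dots> = (\<Sum>B\<in>Pow (\<Gamma> c). real (card (logs \<Gamma> cs n ((U - {c}) \<union> B))))"
      by simp
    also have "\<dots> \<le> (\<Sum>B\<in>Pow (\<Gamma> c). ?l ^ n * (z ^ (card U - 1) * z ^ card B))"
    proof (intro sum_mono)
      fix B assume B: "B \<in> Pow (\<Gamma> c)"
      have "card ((U - {c}) \<union> B) = card (U - {c}) + card B"
        using B U' \<open>finite U\<close> \<Gamma>c by (intro card_Un_disjoint) (auto intro: finite_subset)
      also have "card (U - {c}) = card U - 1"
        using \<open>c \<in> U\<close> by (simp add: card_Diff_singleton)
      finally show "real (card (logs \<Gamma> cs n ((U - {c}) \<union> B)))
          \<le> ?l ^ n * (z ^ (card U - 1) * z ^ card B)"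
        using Suc.IH[of "(U - {c}) \<union> B"] by (simp add: power_add)
    qed
    also have "\<dots> = ?l ^ n * z ^ (card U - 1) * (1 + z) ^ card (\<Gamma> c)"
      using \<Gamma>c by (simp add: sum_Pow_power[symmetric] sum_distrib_left mult.assoc)
    also have "\<dots> \<le> ?l ^ n * z ^ (card U - 1) * (1 + z) ^ g"
      using z \<Gamma>c by (intro mult_left_mono power_increasing) auto
    also have "\<dots> = ?l ^ Suc n * z ^ card U"
    proof -
      have "card U = Suc (card U - 1)"
        using \<open>c \<in> U\<close> \<open>finite U\<close> card_gt_0_iff[of U] by auto
      then have "z ^ card U = z * z ^ (card U - 1)" by (metis power_Suc)
      then show ?thesis using z by simp
    qed
    finally show ?thesis .
  qed
qed

text \<open>The pending set of the whole log may be any set of clauses; summing the weights over all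
  of them gives the last factor.\<close>

lemma card_valid_logs:
  fixes z :: real
  assumes z: "z > 0"
    and \<Gamma>: "\<And>c. c \<in> set cs \<Longrightarrow> finite (\<Gamma> c) \<and> card (\<Gamma> c) \<le> g \<and> c \<in> \<Gamma> c"
  shows "real (card {w. length w = n \<and> valid_log \<Gamma> cs w})
    \<le> ((1 + z) ^ g / z) ^ n * (1 + z) ^ length cs"
proof -
  have "{w. length w = n \<and> valid_log \<Gamma> cs w} \<subseteq> (\<Union>U\<in>Pow (set cs). logs \<Gamma> cs n U)"
  proof
    fix w assume w: "w \<in> {w. length w = n \<and> valid_log \<Gamma> cs w}"
    then have "pending \<Gamma> w \<subseteq> set cs"
      using order.trans[OF pending_subset[of \<Gamma> w] valid_log_subset[of \<Gamma> cs w]] by simp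
    with w show "w \<in> (\<Union>U\<in>Pow (set cs). logs \<Gamma> cs n U)" by (simp add: logs_def)
  qed
  then have "card {w. length w = n \<and> valid_log \<Gamma> cs w} \<le> card (\<Union>U\<in>Pow (set cs). logs \<Gamma> cs n U)"
    by (rule card_mono[rotated]) (simp add: finite_logs)
  also have "\<dots> \<le> (\<Sum>U\<in>Pow (set cs). card (logs \<Gamma> cs n U))"
    by (intro card_UN_le) auto
  finally have "real (card {w. length w = n \<and> valid_log \<Gamma> cs w})
      \<le> real (\<Sum>U\<in>Pow (set cs). card (logs \<Gamma> cs n U))"
    by (rule of_nat_mono)
  also have "\<dots> = (\<Sum>U\<in>Pow (set cs). real (card (logs \<Gamma> cs n U)))"
    by simp
  also have "\<dots> \<le> (\<Sum>U\<in>Pow (set cs). ((1 + z) ^ g / z) ^ n * z ^ card U)"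
    by (rule sum_mono) (rule card_logs[OF z \<Gamma>])
  also have "\<dots> = ((1 + z) ^ g / z) ^ n * (1 + z) ^ card (set cs)"
    by (simp add: sum_Pow_power[symmetric] sum_distrib_left)
  also have "\<dots> \<le> ((1 + z) ^ g / z) ^ n * (1 + z) ^ length cs"
    using z by (intro mult_left_mono power_increasing) (auto simp: card_length)
  finally show ?thesis .
qed

section \<open>Resampling the first violated clause\<close>

definition sat :: "assignment \<Rightarrow> literal list \<Rightarrow> bool" where
  "sat a c \<longleftrightarrow> (\<exists>l\<in>set c. lit_holds a l)"

definition cvars :: "literal list \<Rightarrow> nat set" where
  "cvars c = var ` set c"

text \<open>An exhausted supply of coins yields \<^const>\<open>False\<close>, as the machine takes apart an atom into atoms.\<close>

primrec coin :: "bool list \<Rightarrow> bool" where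
  "coin [] \<longleftrightarrow> False"
| "coin (b # r) \<longleftrightarrow> b"

primrec overwrite :: "literal list \<Rightarrow> bool list \<Rightarrow> assignment \<Rightarrow> assignment" where
  "overwrite [] r a = a"
| "overwrite (l # c) r a = overwrite c (tl r) (a(var l := coin r))"

text \<open>\<open>r\<close> is exactly the list of coins consumed, \<open>w\<close> the log and
  \<open>b\<close> the final assignment. No coin may be left over at the end, as otherwise
  \<open>w\<close> and \<open>b\<close> could not determine \<open>r\<close>.\<close>

primrec walk ::
  "literal list list \<Rightarrow> assignment \<Rightarrow> bool list \<Rightarrow> literal list list \<Rightarrow> assignment \<Rightarrow> bool" where
  "walk cs a r [] b \<longleftrightarrow> r = [] \<and> b = a"
| "walk cs a r (c # w) b \<longleftrightarrow> find (\<lambda>c. \<not> sat a c) cs = Some c \<and> length c \<le> length r \<and>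
     walk cs (overwrite c (take (length c) r) a) (drop (length c) r) w b"

definition neighbours :: "literal list list \<Rightarrow> literal list \<Rightarrow> literal list set" where
  "neighbours cs c = {d \<in> set cs. cvars c \<inter> cvars d \<noteq> {}}"

lemma overwrite_other: "x \<notin> cvars c \<Longrightarrow> overwrite c r a x = a x"
  by (induction c arbitrary: r a) (auto simp: cvars_def)

text \<open>Every variable of \<open>c\<close> receives its own coin and no coin is overwritten, so
  the result displays all of them, whatever the assignment was before.\<close>

lemma overwrite_inj:
  assumes "distinct (map var c)" "length r = length c" "length r' = length c"
    and "overwrite c r a = overwrite c r' a'"
  shows "r = r'"
  using assms
proof (induction c arbitrary: r r' a a')
  case (Cons l c)
  obtain b q where r: "r = b # q" using Cons.prems by (cases r) auto
  obtain b' q' where r': "r' = b' # q'" using Cons.prems by (cases r') auto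
  have "q = q'"
    by (rule Cons.IH[of q q' "a(var l := b)" "a'(var l := b')"])
      (use Cons.prems r r' in \<open>simp_all del: fun_upd_apply\<close>)
  moreover have l: "var l \<notin> cvars c"
    using Cons.prems by (auto simp: cvars_def)
  have "overwrite (l # c) r a (var l) = b" "overwrite (l # c) r' a' (var l) = b'"
    using r r' overwrite_other[OF l] by simp_all
  then have "b = b'" using Cons.prems by simp
  ultimately show ?case using r r' by simp
qed simp

primrec positive :: "literal \<Rightarrow> bool" where
  "positive (Pos x) \<longleftrightarrow> True"
| "positive (Neg x) \<longleftrightarrow> False"

lemma lit_holds_iff: "lit_holds a l \<longleftrightarrow> a (var l) = positive l"
  by (cases l) auto

lemma lit_holds_cong: "a (var l) = b (var l) \<Longrightarrow> lit_holds a l = lit_holds b l"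
  by (simp add: lit_holds_iff)

text \<open>All literals of a violated clause are false, which leaves one possible pattern on its
  variables. Hence the values lost in a resampling can be restored from the clause alone.\<close>

lemma unsat_determines:
  assumes "\<not> sat a c" "\<not> sat b c" "x \<in> cvars c"
  shows "a x = b x"
proof -
  obtain l where "l \<in> set c" "x = var l" using assms(3) by (auto simp: cvars_def)
  with assms(1,2) have "\<not> lit_holds a l" "\<not> lit_holds b l" "x = var l"
    by (auto simp: sat_def)
  then show ?thesis by (simp add: lit_holds_iff)
qed

lemma sat_overwrite: "cvars c \<inter> cvars d = {} \<Longrightarrow> sat (overwrite c r a) d = sat a d"
  unfolding sat_def
  by (intro bex_cong refl lit_holds_cong overwrite_other) (auto simp: cvars_def)

text \<open>A log can be undone from its end: the assignment after a step shows the coins of that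
  step, the variables of \<open>c\<close> had the values that violate \<open>c\<close>, and all
  others are unchanged.\<close>

lemma walk_inj:
  assumes "\<forall>c\<in>set cs. distinct (map var c)" and "walk cs a r w b" "walk cs a' r' w b"
  shows "a = a' \<and> r = r'"
  using assms(2,3)
proof (induction w arbitrary: a r a' r')
  case (Cons c w)
  from Cons.prems have c: "find (\<lambda>c. \<not> sat a c) cs = Some c" "find (\<lambda>c. \<not> sat a' c) cs = Some c"
    by auto
  then have unsat: "\<not> sat a c" "\<not> sat a' c" "c \<in> set cs" by (auto simp: find_Some_iff)
  have eq: "overwrite c (take (length c) r) a = overwrite c (take (length c) r') a'"
      "drop (length c) r = drop (length c) r'"
    using Cons.IH Cons.prems by auto
  then have "take (length c) r = take (length c) r'"
    using Cons.prems assms(1) unsat by (intro overwrite_inj[of c _ _ a a']) auto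
  with eq(2) have "r = r'" by (metis append_take_drop_id)
  moreover have "a = a'"
  proof
    fix x show "a x = a' x"
    proof (cases "x \<in> cvars c")
      case True
      then show ?thesis using unsat unsat_determines by blast
    next
      case False
      then show ?thesis using eq(1) overwrite_other[OF False] by metis
    qed
  qed
  ultimately show ?case by simp
qed simp

text \<open>A pending clause is violated when it is resampled, and no earlier step touches its
  variables, so the violation goes back to the start.\<close>

lemma walk_pending:
  "walk cs a r w b \<Longrightarrow> d \<in> pending (neighbours cs) w \<Longrightarrow> \<not> sat a d \<and> d \<in> set cs"
proof (induction w arbitrary: a r)
  case (Cons c w)
  show ?case
  proof (cases "d = c")
    case True
    then show ?thesis using Cons.prems by (auto simp: find_Some_iff)
  next
    case False
    then have d: "d \<in> pending (neighbours cs) w" "d \<notin> neighbours cs c"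
      using Cons.prems by auto
    then have "\<not> sat (overwrite c (take (length c) r) a) d \<and> d \<in> set cs"
      using Cons by auto
    then show ?thesis
      using d sat_overwrite[of c d] by (auto simp: neighbours_def)
  qed
qed simp

lemma find_stronger:
  "find P xs = Some x \<Longrightarrow> Q x \<Longrightarrow> (\<And>y. Q y \<Longrightarrow> P y) \<Longrightarrow> find Q xs = Some x"
  by (induction xs) (auto split: if_splits)

text \<open>\<open>c\<close> is the first violated clause, it is itself pending, and pending clauses
  are violated; so it is also the first pending one.\<close>

lemma walk_valid_log: "walk cs a r w b \<Longrightarrow> valid_log (neighbours cs) cs w"
proof (induction w arbitrary: a r)
  case (Cons c w)
  have "find (\<lambda>d. d \<in> pending (neighbours cs) (c # w)) cs = Some c"
  proof (rule find_stronger)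
    show "find (\<lambda>c. \<not> sat a c) cs = Some c" using Cons.prems by simp
    show "c \<in> pending (neighbours cs) (c # w)" by simp
    show "\<not> sat a d" if "d \<in> pending (neighbours cs) (c # w)" for d
      using walk_pending[OF Cons.prems that] by simp
  qed
  then show ?case using Cons by auto
qed simp

lemma walk_other: "walk cs a r w b \<Longrightarrow> x \<notin> (\<Union>c\<in>set cs. cvars c) \<Longrightarrow> b x = a x"
proof (induction w arbitrary: a r)
  case (Cons c w)
  then have "b x = overwrite c (take (length c) r) a x" "c \<in> set cs"
    by (auto simp: find_Some_iff)
  then show ?case using Cons.prems overwrite_other[of x c] by auto
qed simp

lemma finite_cvars: "finite (cvars c)"
  by (simp add: cvars_def)

text \<open>A string is recovered from its log and the variables of \<open>V\<close> that are true
  at the end, since outside \<open>V\<close> the final assignment still agrees with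
  \<open>a\<close>. This costs one bit per variable.\<close>

lemma card_walks:
  assumes "\<forall>c\<in>set cs. distinct (map var c)"
  defines "V \<equiv> \<Union>c\<in>set cs. cvars c"
  shows "finite {r. \<exists>w b. length w = n \<and> walk cs a r w b}"
    and "card {r. \<exists>w b. length w = n \<and> walk cs a r w b}
      \<le> card {w. length w = n \<and> valid_log (neighbours cs) cs w} * 2 ^ card V"
proof -
  let ?W = "{w. length w = n \<and> valid_log (neighbours cs) cs w}"
  let ?g = "\<lambda>(w, A). THE r. walk cs a r w (\<lambda>x. if x \<in> V then x \<in> A else a x)"
  have sub: "{r. \<exists>w b. length w = n \<and> walk cs a r w b} \<subseteq> ?g ` (?W \<times> Pow V)"
  proof
    fix r assume "r \<in> {r. \<exists>w b. length w = n \<and> walk cs a r w b}"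
    then obtain w b where w: "length w = n" "walk cs a r w b" by auto
    define A where "A = {x \<in> V. b x}"
    have "b = (\<lambda>x. if x \<in> V then x \<in> A else a x)"
      using walk_other[OF w(2)] by (auto simp: A_def V_def)
    with w(2) have r: "walk cs a r w (\<lambda>x. if x \<in> V then x \<in> A else a x)" by simp
    have "?g (w, A) = r"
      unfolding prod.case using r walk_inj[OF assms(1)] by (intro the_equality) blast+
    moreover have "(w, A) \<in> ?W \<times> Pow V"
      using w walk_valid_log by (auto simp: A_def)
    ultimately show "r \<in> ?g ` (?W \<times> Pow V)" by (intro image_eqI[of _ _ "(w, A)"]) simp_all
  qed
  have fin: "finite V" by (auto simp: V_def finite_cvars)
  then have "finite (?W \<times> Pow V)" using finite_valid_logs by blast
  then show "finite {r. \<exists>w b. length w = n \<and> walk cs a r w b}"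
    using sub by (meson finite_surj)
  have "card {r. \<exists>w b. length w = n \<and> walk cs a r w b} \<le> card (?W \<times> Pow V)"
    using sub \<open>finite (?W \<times> Pow V)\<close> by (rule surj_card_le[rotated])
  then show "card {r. \<exists>w b. length w = n \<and> walk cs a r w b} \<le> card ?W * 2 ^ card V"
    using fin by (simp add: card_cartesian_product card_Pow)
qed

section \<open>Resampling with assignments kept as lists\<close>

lemma overwrite_take: "overwrite c (take (length c) r) a = overwrite c r a"
proof (induction c arbitrary: r a)
  case (Cons l c)
  then show ?case by (cases r) (simp_all del: fun_upd_apply)
qed simp

text \<open>\<open>s\<close> lists the true variables. Setting a variable to true may create a
  duplicate, so setting it to false has to delete all copies.\<close>

definition assign :: "nat \<Rightarrow> bool \<Rightarrow> nat list \<Rightarrow> nat list" where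
  "assign x b s = (if b then x # s else removeAll x s)"

primrec resample :: "literal list \<Rightarrow> bool list \<Rightarrow> nat list \<Rightarrow> nat list" where
  "resample [] r s = s"
| "resample (l # c) r s = resample c (tl r) (assign (var l) (coin r) s)"

text \<open>The first violated clause is the head of the suffix. The clause alone would not do as a
  result: an empty clause has the same encoding as the empty list, which stands for success.\<close>

definition unsat :: "literal list list \<Rightarrow> nat list \<Rightarrow> literal list list" where
  "unsat cs s = dropWhile (sat (assignment_of s)) cs"

text \<open>An empty clause ends the run, as it cannot be satisfied and would consume no coins. If
  fewer coins than literals remain, the step is carried out with the default \<open>False\<close>;
  this is harmless, since success is always tested.\<close>

function mt :: "literal list list \<Rightarrow> nat list \<Rightarrow> bool list \<Rightarrow> nat list option" where
  "mt cs s r = (case unsat cs s of [] \<Rightarrow> Some s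
     | c # _ \<Rightarrow> if c = [] \<or> r = [] then None else mt cs (resample c r s) (drop (length c) r))"
  by pat_completeness auto
termination by (relation "measure (\<lambda>(cs, s, r). length r)") auto

declare mt.simps [simp del]

lemma assignment_of_assign: "assignment_of (assign x b s) = (assignment_of s)(x := b)"
  by (auto simp: assignment_of_def assign_def fun_eq_iff)

lemma assignment_of_resample:
  "assignment_of (resample c r s) = overwrite c r (assignment_of s)"
  by (induction c arbitrary: r s) (simp_all add: assignment_of_assign)

lemma unsat_Nil: "unsat cs s = [] \<longleftrightarrow> (\<forall>c\<in>set cs. sat (assignment_of s) c)"
  by (simp add: unsat_def)

lemma unsat_Cons:
  "unsat cs s = c # ds \<Longrightarrow> find (\<lambda>c. \<not> sat (assignment_of s) c) cs = Some c"
  unfolding unsat_def by (induction cs) (auto split: if_splits)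

lemma mt_sound: "mt cs s r = Some s' \<Longrightarrow> \<forall>c\<in>set cs. sat (assignment_of s') c"
proof (induction cs s r rule: mt.induct)
  case (1 cs s r)
  show ?case
  proof (cases "unsat cs s")
    case Nil
    then have "s' = s" using 1(2) by (simp add: mt.simps[of cs s r])
    with Nil show ?thesis by (simp add: unsat_Nil)
  next
    case (Cons c ds)
    then show ?thesis using 1 by (simp add: mt.simps[of cs s r] split: if_splits)
  qed
qed

text \<open>All clauses have \<open>k > 0\<close> literals, so a failure can come only from
  exhausted coins, and at least \<open>n\<close> complete steps precede it.\<close>

lemma mt_failure_walk:
  assumes "\<forall>c\<in>set cs. length c = k" "k > 0"
    and "mt cs s r = None" "k * n \<le> length r"
  shows "\<exists>w b. length w = n \<and> walk cs (assignment_of s) (take (k * n) r) w b"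
  using assms(3,4)
proof (induction n arbitrary: s r)
  case (Suc n)
  from Suc.prems(1) obtain c ds where c: "unsat cs s = c # ds"
    by (cases "unsat cs s") (auto simp: mt.simps[of cs s r])
  note find = unsat_Cons[OF c]
  then have "c \<in> set cs" by (auto simp: find_Some_iff)
  with assms have len: "length c = k" by auto
  with assms(2) have "c \<noteq> []" by auto
  have "r \<noteq> []" using Suc.prems assms(2) by auto
  with Suc.prems c \<open>c \<noteq> []\<close> len have "mt cs (resample c r s) (drop k r) = None"
    by (simp add: mt.simps[of cs s r])
  then obtain w b where w: "length w = n"
      "walk cs (overwrite c r (assignment_of s)) (take (k * n) (drop k r)) w b"
    using Suc.IH[of "resample c r s" "drop k r"] Suc.prems(2)
    by (auto simp: assignment_of_resample add_le_imp_le_diff)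
  have "take k (take (k * Suc n) r) = take k r" by (simp add: min_def)
  moreover have "drop k (take (k * Suc n) r) = take (k * n) (drop k r)"
    by (simp add: drop_take)
  moreover have "overwrite c (take k r) (assignment_of s) = overwrite c r (assignment_of s)"
    using overwrite_take[of c r] len by simp
  ultimately have "walk cs (assignment_of s) (take (k * Suc n) r) (c # w) b"
    using find w Suc.prems len by simp
  moreover have "length (c # w) = Suc n" using w by simp
  ultimately show ?case by blast
qed (auto intro!: exI[of _ "[]"])

lemma finite_bool_lists: "finite {r :: bool list. length r = n}"
  using finite_lists_length_eq[of "UNIV :: bool set" n] by simp

lemma card_bool_lists: "card {r :: bool list. length r = n} = 2 ^ n"
  using card_lists_length_eq[of "UNIV :: bool set" n] by simp

text \<open>A failing string is a walk of \<open>n\<close> steps followed by arbitrary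
  coins.\<close>

lemma card_mt_failures:
  assumes "\<forall>c\<in>set cs. length c = k \<and> distinct (map var c)" "k > 0" "k * n \<le> L"
  defines "V \<equiv> \<Union>c\<in>set cs. cvars c"
  shows "card {r. length r = L \<and> mt cs s r = None}
    \<le> card {w. length w = n \<and> valid_log (neighbours cs) cs w} * 2 ^ card V * 2 ^ (L - k * n)"
proof -
  let ?X = "{r. \<exists>w b. length w = n \<and> walk cs (assignment_of s) r w b}"
  let ?Y = "{r :: bool list. length r = L - k * n}"
  have X: "finite ?X" "card ?X \<le> card {w. length w = n \<and> valid_log (neighbours cs) cs w} * 2 ^ card V"
    unfolding V_def using assms(1) by (intro card_walks; simp)+
  have "{r. length r = L \<and> mt cs s r = None} \<subseteq> (\<lambda>(p, q). p @ q) ` (?X \<times> ?Y)"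
  proof
    fix r assume r: "r \<in> {r. length r = L \<and> mt cs s r = None}"
    then have "take (k * n) r \<in> ?X"
      using mt_failure_walk[of cs k s r n] assms by auto
    moreover have "drop (k * n) r \<in> ?Y" using r by simp
    ultimately show "r \<in> (\<lambda>(p, q). p @ q) ` (?X \<times> ?Y)"
      by (intro image_eqI[of _ _ "(take (k * n) r, drop (k * n) r)"]) simp_all
  qed
  then have "card {r. length r = L \<and> mt cs s r = None} \<le> card (?X \<times> ?Y)"
    using X finite_bool_lists by (intro surj_card_le) auto
  also have "\<dots> = card ?X * 2 ^ (L - k * n)"
    by (simp add: card_cartesian_product card_bool_lists)
  also have "\<dots> \<le> card {w. length w = n \<and> valid_log (neighbours cs) cs w} * 2 ^ card V
      * 2 ^ (L - k * n)"
    by (rule mult_right_mono[OF X(2)]) simp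
  finally show ?thesis .
qed

section \<open>Estimates for the number of failing strings\<close>

lemma card_neighbours:
  assumes "\<And>x. card {c \<in> set cs. x \<in> cvars c} \<le> d" "length c = k"
  shows "finite (neighbours cs c)" "card (neighbours cs c) \<le> k * d"
proof -
  show "finite (neighbours cs c)" by (simp add: neighbours_def)
  have "neighbours cs c = (\<Union>x\<in>cvars c. {c \<in> set cs. x \<in> cvars c})"
    by (auto simp: neighbours_def)
  then have "card (neighbours cs c) \<le> (\<Sum>x\<in>cvars c. card {c \<in> set cs. x \<in> cvars c})"
    using card_UN_le[OF finite_cvars[of c]] by metis
  also have "\<dots> \<le> card (cvars c) * d"
    using sum_bounded_above[of "cvars c" _ d] assms(1) by simp
  also have "card (cvars c) \<le> k"
    unfolding cvars_def using assms(2) card_image_le[of "set c" var] card_length[of c] by simp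
  finally show "card (neighbours cs c) \<le> k * d" by simp
qed

text \<open>\<open>z = 1 / (G - 1)\<close> minimises \<open>(1 + z) powr G / z\<close>. The minimum
  is \<open>G * (1 + z) powr (G - 1)\<close>, where the power is at most \<open>e\<close>.\<close>

lemma growth_rate_bound:
  fixes G :: real
  assumes "G > 1" "real g \<le> G"
  defines "z \<equiv> 1 / (G - 1)"
  shows "(1 + z) ^ g / z \<le> exp 1 * G"
proof -
  have z: "z > 0" using assms by simp
  have "(1 + z) ^ g = (1 + z) powr real g" using z by (simp add: powr_realpow)
  also have "\<dots> \<le> (1 + z) powr ((G - 1) + 1)"
    using z assms by (intro powr_mono) auto
  also have "\<dots> = (1 + z) powr (G - 1) * (1 + z)" using z by (subst powr_add) simp
  also have "\<dots> \<le> exp 1 * (1 + z)"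
  proof (rule mult_right_mono)
    have "(G - 1) * ln (1 + z) \<le> (G - 1) * z"
      using assms z by (intro mult_left_mono ln_add_one_self_le_self) auto
    also have "\<dots> = 1" using assms by simp
    finally show "(1 + z) powr (G - 1) \<le> exp 1" using z by (simp add: powr_def)
  qed (use z in simp)
  finally have "(1 + z) ^ g / z \<le> exp 1 * (1 + z) / z" using z by (intro divide_right_mono) auto
  also have "(1 + z) / z = G" using assms by (simp add: field_simps)
  then have "exp 1 * (1 + z) / z = exp 1 * G" by (metis times_divide_eq_right)
  finally show ?thesis .
qed

text \<open>Every \<open>q\<close> factors contribute at most \<open>1 / e\<close> \<le>
  \<open>1 / 2\<close>: the slack saves one bit in \<open>q\<close> steps.\<close>

lemma half_power_bound:
  fixes q :: real
  assumes "q \<ge> 1"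
  shows "(1 - 1 / q) ^ n \<le> (1 / 2) powr (real n / q)"
proof -
  have "(1 - 1 / q) ^ n \<le> exp (- 1 / q) ^ n"
    using assms exp_ge_add_one_self[of "- 1 / q"] by (intro power_mono) auto
  also have "\<dots> = exp (- 1) powr (real n / q)"
    by (simp add: exp_of_nat_mult[symmetric] powr_def)
  also have "\<dots> \<le> (1 / 2) powr (real n / q)"
  proof (intro powr_mono2)
    have "exp (1 :: real) \<ge> 2" using exp_ge_add_one_self[of 1] by simp
    then show "exp (- 1 :: real) \<le> 1 / 2" by (simp add: exp_minus field_simps)
  qed (use assms in auto)
  finally show ?thesis .
qed

text \<open>There are \<open>2 ^ (k * n)\<close> coin strings for \<open>n\<close> steps. By the
  choice of \<open>n\<close>, the factor \<open>(1 - 1 / q) ^ n\<close> in the number of logs is at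
  most \<open>(1 / 2) ^ (length cs + card V + 1)\<close>. It cancels \<open>2 ^ length cs\<close>
  for the first pending set and \<open>2 ^ card V\<close> for the final assignment, and a factor
  \<open>1 / 2\<close> is left.\<close>

lemma few_mt_failures:
  fixes G :: real
  assumes cs: "\<forall>c\<in>set cs. length c = k \<and> distinct (map var c)" "k > 0"
    and deg: "\<And>x. card {c \<in> set cs. x \<in> cvars c} \<le> d"
    and G: "real k * real d \<le> G" "2 \<le> G" "exp 1 * G \<le> 2 ^ k * (1 - 1 / real q)"
    and q: "q > 0" and n: "n = q * (length cs + card (\<Union>c\<in>set cs. cvars c) + 1)"
    and L: "k * n \<le> L"
  shows "2 * card {r. length r = L \<and> mt cs s r = None} \<le> 2 ^ L"
proof -
  define V where "V = (\<Union>c\<in>set cs. cvars c)"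
  define z where "z = 1 / (G - 1)"
  let ?W = "card {w. length w = n \<and> valid_log (neighbours cs) cs w}"
  \<comment> \<open>\<open>z\<close> \<le> 1 comes from \<open>G\<close> \<ge> 2 and makes the
    choice of the first pending set cost at most one bit per clause.\<close>
  have z: "0 < z" "z \<le> 1" using G by (auto simp: z_def)
  have "real ?W \<le> ((1 + z) ^ (k * d) / z) ^ n * (1 + z) ^ length cs"
  proof (rule card_valid_logs[OF z(1)])
    fix c assume c: "c \<in> set cs"
    then have "cvars c \<noteq> {}" using cs by (auto simp: cvars_def)
    then show "finite (neighbours cs c) \<and> card (neighbours cs c) \<le> k * d \<and> c \<in> neighbours cs c"
      using card_neighbours[of cs d c k] deg cs c by (auto simp: neighbours_def)
  qed
  also have "\<dots> \<le> (2 ^ k * (1 - 1 / real q)) ^ n * 2 ^ length cs"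
  proof (rule mult_mono)
    have "(1 + z) ^ (k * d) / z \<le> exp 1 * G"
      unfolding z_def using G by (intro growth_rate_bound) auto
    with G(3) z show "((1 + z) ^ (k * d) / z) ^ n \<le> (2 ^ k * (1 - 1 / real q)) ^ n"
      by (intro power_mono) auto
    show "(1 + z) ^ length cs \<le> 2 ^ length cs" using z by (intro power_mono) auto
  qed (use z q in auto)
  also have "\<dots> = 2 ^ (k * n) * (1 - 1 / real q) ^ n * 2 ^ length cs"
    by (simp add: power_mult power_mult_distrib)
  also have "\<dots> \<le> 2 ^ (k * n) * (1 / 2) ^ (length cs + card V + 1) * 2 ^ length cs"
  proof (intro mult_right_mono mult_left_mono)
    have "(1 - 1 / real q) ^ n \<le> (1 / 2) powr (real n / real q)"
      using q by (intro half_power_bound) auto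
    also have "real n / real q = real (length cs + card V + 1)"
      unfolding n V_def[symmetric] of_nat_mult
      using q by (intro nonzero_mult_div_cancel_left) simp
    finally show "(1 - 1 / real q) ^ n \<le> (1 / 2) ^ (length cs + card V + 1)"
      by (subst (asm) powr_realpow) simp_all
  qed auto
  also have "\<dots> = 2 ^ (k * n) / (2 * 2 ^ card V)"
    by (simp add: power_add power_one_over field_simps)
  finally have W: "real ?W * (2 * 2 ^ card V) \<le> 2 ^ (k * n)"
    by (simp add: field_simps)
  have "card {r. length r = L \<and> mt cs s r = None} \<le> ?W * 2 ^ card V * 2 ^ (L - k * n)"
    unfolding V_def using cs L by (intro card_mt_failures) auto
  then have "2 * card {r. length r = L \<and> mt cs s r = None} \<le> ?W * (2 * 2 ^ card V) * 2 ^ (L - k * n)"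
    by simp
  also have "?W * (2 * 2 ^ card V) \<le> 2 ^ (k * n)"
  proof -
    have "real (?W * (2 * 2 ^ card V)) \<le> real (2 ^ (k * n))" using W by simp
    then show ?thesis by (simp only: of_nat_le_iff)
  qed
  then have "?W * (2 * 2 ^ card V) * 2 ^ (L - k * n) \<le> 2 ^ (k * n) * 2 ^ (L - k * n)"
    by (rule mult_right_mono) simp
  also have "(2 :: nat) ^ (k * n) * 2 ^ (L - k * n) = 2 ^ L"
    using L by (simp add: power_add[symmetric])
  finally show ?thesis .
qed

section \<open>An evaluator for the machine model\<close>

text \<open>Evaluation is a deterministic relation, so the chosen pair is its only result. As a
  partial function it can be computed by rewriting.\<close>

definition result_of :: "('a \<Rightarrow> nat \<Rightarrow> bool) \<Rightarrow> ('a \<times> nat) option" where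
  "result_of R = (if \<exists>p. R (fst p) (snd p) then Some (SOME p. R (fst p) (snd p)) else None)"

definition res :: "program \<Rightarrow> tree list \<Rightarrow> expr \<Rightarrow> (tree \<times> nat) option" where
  "res P \<rho> e = result_of (eval P \<rho> e)"

definition ress :: "program \<Rightarrow> tree list \<Rightarrow> expr list \<Rightarrow> (tree list \<times> nat) option" where
  "ress P \<rho> es = result_of (evals P \<rho> es)"

text \<open>Stays folded during simplification: symbolic execution stops at a call, where the proven
  result of the callee or an induction hypothesis is inserted.\<close>

definition call :: "program \<Rightarrow> nat \<Rightarrow> tree list \<Rightarrow> (tree \<times> nat) option" where
  "call P i us = res P us (P ! i)"

definition delay :: "nat \<Rightarrow> ('a \<times> nat) option \<Rightarrow> ('a \<times> nat) option" where
  "delay t m = map_option (\<lambda>(v, s). (v, s + t)) m"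

text \<open>The bind of the monad of partial computations with a step counter.\<close>

definition bnd :: "('a \<times> nat) option \<Rightarrow> ('a \<Rightarrow> ('b \<times> nat) option) \<Rightarrow> ('b \<times> nat) option" where
  "bnd m f = (case m of None \<Rightarrow> None | Some (v, t) \<Rightarrow> delay t (f v))"

lemma result_of_iff:
  assumes "\<And>v t v' t'. R v t \<Longrightarrow> R v' t' \<Longrightarrow> v = v' \<and> t = t'"
  shows "result_of R = Some (v, t) \<longleftrightarrow> R v t"
proof
  assume *: "result_of R = Some (v, t)"
  have "\<exists>p. R (fst p) (snd p)"
  proof (rule ccontr)
    assume "\<nexists>p. R (fst p) (snd p)"
    then have "result_of R = None" unfolding result_of_def by (rule if_not_P)
    with * show False by simp
  qed
  then have "R (fst (SOME p. R (fst p) (snd p))) (snd (SOME p. R (fst p) (snd p)))"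
    by (rule someI_ex)
  moreover have "(SOME p. R (fst p) (snd p)) = (v, t)"
    using * by (simp add: result_of_def split: if_splits)
  ultimately show "R v t" by simp
next
  assume R: "R v t"
  have "(SOME p. R (fst p) (snd p)) = (v, t)"
  proof (rule some_equality)
    show "R (fst (v, t)) (snd (v, t))" using R by simp
    show "p = (v, t)" if "R (fst p) (snd p)" for p
      using assms[OF that R] by (simp add: prod_eq_iff)
  qed
  moreover have "\<exists>p. R (fst p) (snd p)" using R by (intro exI[of _ "(v, t)"]) simp
  ultimately show "result_of R = Some (v, t)" by (simp add: result_of_def)
qed

lemma res_iff: "res P \<rho> e = Some (v, t) \<longleftrightarrow> eval P \<rho> e v t"
  unfolding res_def by (rule result_of_iff) (rule eval_deterministic_aux)

lemma ress_iff: "ress P \<rho> es = Some (vs, t) \<longleftrightarrow> evals P \<rho> es vs t"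
  unfolding ress_def by (rule result_of_iff) (rule eval_deterministic_aux)

lemma option_eqI:
  assumes "\<And>v t. m = Some (v, t) \<longleftrightarrow> m' = Some (v, t)"
  shows "m = m'"
proof (cases m)
  case None
  then have "m' \<noteq> Some p" for p using assms[of "fst p" "snd p"] by simp
  with None show ?thesis by (cases m') auto
next
  case (Some p)
  with assms[of "fst p" "snd p"] show ?thesis by simp
qed

lemma delay_eq_Some: "delay t m = Some (v, s) \<longleftrightarrow> (\<exists>s'. m = Some (v, s') \<and> s = s' + t)"
  by (auto simp: delay_def)

lemma bnd_eq_Some:
  "bnd m f = Some (v, t) \<longleftrightarrow> (\<exists>u s s'. m = Some (u, s) \<and> f u = Some (v, s') \<and> t = s + s')"
  by (auto simp: bnd_def delay_eq_Some split: option.splits)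

lemmas eval_intros = eval_evals.intros[folded Suc_eq_plus1, unfolded One_nat_def]

lemma eval_iffs:
  "eval P \<rho> (VarE i) w t \<longleftrightarrow> i < length \<rho> \<and> w = \<rho> ! i \<and> t = Suc 0"
  "eval P \<rho> AtomE w t \<longleftrightarrow> w = Atom \<and> t = Suc 0"
  "eval P \<rho> (CellE e f) w t \<longleftrightarrow>
    (\<exists>u s v s'. eval P \<rho> e u s \<and> eval P \<rho> f v s' \<and> w = Cell u v \<and> t = Suc (s + s'))"
  "eval P \<rho> (LeftE e) w t \<longleftrightarrow> (\<exists>u s. eval P \<rho> e u s \<and> w = left u \<and> t = Suc s)"
  "eval P \<rho> (RightE e) w t \<longleftrightarrow> (\<exists>u s. eval P \<rho> e u s \<and> w = right u \<and> t = Suc s)"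
  "eval P \<rho> (IfE c e f) w t \<longleftrightarrow>
    (\<exists>b s s'. eval P \<rho> c b s \<and> b \<noteq> Atom \<and> eval P \<rho> e w s' \<and> t = Suc (s + s')) \<or>
    (\<exists>s s'. eval P \<rho> c Atom s \<and> eval P \<rho> f w s' \<and> t = Suc (s + s'))"
  "eval P \<rho> (LetE e f) w t \<longleftrightarrow>
    (\<exists>u s s'. eval P \<rho> e u s \<and> eval P (u # \<rho>) f w s' \<and> t = Suc (s + s'))"
  "eval P \<rho> (CallE i es) w t \<longleftrightarrow>
    (\<exists>us s s'. evals P \<rho> es us s \<and> i < length P \<and> eval P us (P ! i) w s' \<and> t = Suc (s + s'))"
  "evals P \<rho> [] us t \<longleftrightarrow> us = [] \<and> t = 0"
  "evals P \<rho> (e # es) us t \<longleftrightarrow>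
    (\<exists>v s vs s'. eval P \<rho> e v s \<and> evals P \<rho> es vs s' \<and> us = v # vs \<and> t = s + s')"
  subgoal by (blast intro: eval_intros elim: eval_elims)
  subgoal by (blast intro: eval_intros elim: eval_elims)
  subgoal by (blast intro: eval_intros elim: eval_elims)
  subgoal by (blast intro: eval_intros elim: eval_elims)
  subgoal by (blast intro: eval_intros elim: eval_elims)
  subgoal by (blast intro: eval_intros elim: eval_elims)
  subgoal by (blast intro: eval_intros elim: eval_elims)
  subgoal by (blast intro: eval_intros elim: eval_elims)
  subgoal by (blast intro: eval_intros elim: eval_elims)
  subgoal by (blast intro: eval_intros elim: eval_elims)
  done

text \<open>As rewrite rules these execute an expression symbolically and add up its steps.\<close>

lemma res_simps [simp]:
  "res P \<rho> (VarE i) = (if i < length \<rho> then Some (\<rho> ! i, 1) else None)"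
  "res P \<rho> AtomE = Some (Atom, 1)"
  "res P \<rho> (CellE e f) = delay 1 (bnd (res P \<rho> e) (\<lambda>u. bnd (res P \<rho> f) (\<lambda>v. Some (Cell u v, 0))))"
  "res P \<rho> (LeftE e) = delay 1 (bnd (res P \<rho> e) (\<lambda>v. Some (left v, 0)))"
  "res P \<rho> (RightE e) = delay 1 (bnd (res P \<rho> e) (\<lambda>v. Some (right v, 0)))"
  "res P \<rho> (IfE c e f) = delay 1 (bnd (res P \<rho> c) (\<lambda>b. if b = Atom then res P \<rho> f else res P \<rho> e))"
  "res P \<rho> (LetE e f) = delay 1 (bnd (res P \<rho> e) (\<lambda>u. res P (u # \<rho>) f))"
  "res P \<rho> (CallE i es) =
    delay 1 (bnd (ress P \<rho> es) (\<lambda>us. if i < length P then call P i us else None))"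
  "ress P \<rho> [] = Some ([], 0)"
  "ress P \<rho> (e # es) = bnd (res P \<rho> e) (\<lambda>u. bnd (ress P \<rho> es) (\<lambda>us. Some (u # us, 0)))"
  subgoal
    by (rule option_eqI)
      (auto simp: res_iff ress_iff eval_iffs delay_eq_Some bnd_eq_Some call_def split: if_splits)
  subgoal
    by (rule option_eqI)
      (auto simp: res_iff ress_iff eval_iffs delay_eq_Some bnd_eq_Some call_def split: if_splits)
  subgoal
    by (rule option_eqI) (simp add: res_iff ress_iff eval_iffs delay_eq_Some bnd_eq_Some, blast)
  subgoal
    by (rule option_eqI)
      (auto simp: res_iff ress_iff eval_iffs delay_eq_Some bnd_eq_Some call_def split: if_splits)
  subgoal
    by (rule option_eqI)
      (auto simp: res_iff ress_iff eval_iffs delay_eq_Some bnd_eq_Some call_def split: if_splits)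
  subgoal
    by (rule option_eqI)
      (auto simp: res_iff ress_iff eval_iffs delay_eq_Some bnd_eq_Some call_def split: if_splits)
  subgoal
    by (rule option_eqI)
      (auto simp: res_iff ress_iff eval_iffs delay_eq_Some bnd_eq_Some call_def split: if_splits)
  subgoal
    by (rule option_eqI)
      (auto simp: res_iff ress_iff eval_iffs delay_eq_Some bnd_eq_Some call_def split: if_splits)
  subgoal
    by (rule option_eqI)
      (auto simp: res_iff ress_iff eval_iffs delay_eq_Some bnd_eq_Some call_def split: if_splits)
  subgoal
    by (rule option_eqI) (simp add: res_iff ress_iff eval_iffs delay_eq_Some bnd_eq_Some, blast)
  done

lemma delay_simps [simp]:
  "delay t None = None" "delay t (Some (v, s)) = Some (v, s + t)"
  "delay t (delay s m) = delay (s + t) m"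
  by (cases m; auto simp: delay_def)+

lemma bnd_simps [simp]:
  "bnd None f = None" "bnd (Some (v, t)) f = delay t (f v)" "bnd (delay t m) f = delay t (bnd m f)"
  by (cases m; auto simp: bnd_def)+

definition gives :: "('a \<times> nat) option \<Rightarrow> 'a \<Rightarrow> nat \<Rightarrow> bool" where
  "gives m v b \<longleftrightarrow> (\<exists>t\<le>b. m = Some (v, t))"

lemma gives_mono: "gives m v b \<Longrightarrow> b \<le> b' \<Longrightarrow> gives m v b'"
  by (auto simp: gives_def intro: order.trans)

lemma givesE:
  assumes "gives m v b"
  obtains t where "m = Some (v, t)" "t \<le> b"
  using assms by (auto simp: gives_def)

section \<open>The programs\<close>

text \<open>
  Index 0 is left to the entry points \<open>search_main\<close> and \<open>try_main\<close>, which share all other function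
  bodies.  Index 1 is written \<^term>\<open>Suc 0\<close>, the normal form of the simplifier.
\<close>

abbreviation (input) "f_eq \<equiv> Suc 0"
abbreviation (input) "f_mem \<equiv> 2"
abbreviation (input) "f_rem \<equiv> 3"
abbreviation (input) "f_assign \<equiv> 4"
abbreviation (input) "f_holds \<equiv> 5"
abbreviation (input) "f_sat \<equiv> 6"
abbreviation (input) "f_unsat \<equiv> 7"
abbreviation (input) "f_init \<equiv> 8"
abbreviation (input) "f_search \<equiv> 9"
abbreviation (input) "f_branch \<equiv> 10"
abbreviation (input) "f_resample \<equiv> 11"
abbreviation (input) "f_drop \<equiv> 12"
abbreviation (input) "f_mt \<equiv> 13"
abbreviation (input) "f_tails \<equiv> 14"
abbreviation (input) "f_try \<equiv> 15"
abbreviation (input) "f_occ \<equiv> 16"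
abbreviation (input) "f_codeg \<equiv> 17"
abbreviation (input) "f_leq \<equiv> 18"
abbreviation (input) "f_ins \<equiv> 19"
abbreviation (input) "f_sort \<equiv> 20"
abbreviation (input) "f_sortall \<equiv> 21"

abbreviation (input) "TrueE \<equiv> CellE AtomE AtomE"
abbreviation (input) "V0 \<equiv> VarE 0"
abbreviation (input) "V1 \<equiv> VarE 1"
abbreviation (input) "V2 \<equiv> VarE 2"
abbreviation (input) "V3 \<equiv> VarE 3"
abbreviation (input) "V4 \<equiv> VarE 4"

definition eq_body :: expr where
  "eq_body = IfE V0
      (IfE V1
        (IfE (CallE f_eq [LeftE V0, LeftE V1]) (CallE f_eq [RightE V0, RightE V1]) AtomE)
        AtomE)
      (IfE V1 AtomE TrueE)"

definition mem_body :: expr where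
  "mem_body = IfE V1 (IfE (CallE f_eq [V0, LeftE V1]) TrueE (CallE f_mem [V0, RightE V1])) AtomE"

definition rem_body :: expr where
  "rem_body = IfE V1
      (IfE (CallE f_eq [V0, LeftE V1])
        (CallE f_rem [V0, RightE V1])
        (CellE (LeftE V1) (CallE f_rem [V0, RightE V1])))
      AtomE"

definition assign_body :: expr where
  "assign_body = IfE V1 (CellE V0 V2) (CallE f_rem [V0, V2])"

definition holds_body :: expr where
  "holds_body = IfE (LeftE V0)
      (CallE f_mem [RightE V0, V1])
      (IfE (CallE f_mem [RightE V0, V1]) AtomE TrueE)"

definition sat_body :: expr where
  "sat_body = IfE V0 (IfE (CallE f_holds [LeftE V0, V1]) TrueE (CallE f_sat [RightE V0, V1])) AtomE"

definition unsat_body :: expr where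
  "unsat_body = IfE V0 (IfE (CallE f_sat [LeftE V0, V1]) (CallE f_unsat [RightE V0, V1]) V0) AtomE"

definition init_body :: expr where
  "init_body = IfE V0
      (CallE f_assign [RightE (LeftE (LeftE V0)), LeftE (LeftE (LeftE V0)),
        CallE f_init [RightE V0]])
      AtomE"

text \<open>Inside \<open>LetE\<close> the arguments are shifted by one: \<open>V1\<close>,
  \<open>V2\<close> and \<open>V3\<close> are the clauses, the assignment and the remaining depth in
  unary.\<close>

definition search_body :: expr where
  "search_body = LetE (CallE f_unsat [V0, V1])
      (IfE V0
        (IfE V3 (CallE f_branch [V1, V2, RightE V3, LeftE V0]) AtomE)
        (CellE AtomE V2))"

definition branch_body :: expr where
  "branch_body = IfE V3
      (LetE (CallE f_search [V0, CallE f_assign [RightE (LeftE V3), LeftE (LeftE V3), V1], V2])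
        (IfE V0 V0 (CallE f_branch [V1, V2, V3, RightE V4])))
      AtomE"

definition resample_body :: expr where
  "resample_body = IfE V0
      (CallE f_resample [RightE V0, RightE V1,
        CallE f_assign [RightE (LeftE V0), LeftE V1, V2]])
      V2"

definition drop_body :: expr where
  "drop_body = IfE V0 (CallE f_drop [RightE V0, RightE V1]) V1"

definition mt_body :: expr where
  "mt_body = LetE (CallE f_unsat [V0, V1])
      (IfE V0
        (IfE (LeftE V0)
          (IfE V3
            (CallE f_mt [V1, CallE f_resample [LeftE V0, V3, V2], CallE f_drop [LeftE V0, V3]])
            AtomE)
          AtomE)
        (CellE AtomE V2))"

definition tails_body :: expr where
  "tails_body = IfE V0 (CellE (RightE (LeftE V0)) (CallE f_tails [RightE V0])) AtomE"

definition try_body :: expr where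
  "try_body = LetE (CallE f_mt [V0, V1, V2])
      (IfE V0 V0 (IfE (LeftE V1) (CallE f_try [CallE f_tails [V1], V2, V3]) AtomE))"

definition occ_body :: expr where
  "occ_body = IfE V1 (IfE (CallE f_eq [V0, RightE (LeftE V1)]) TrueE (CallE f_occ [V0, RightE V1])) AtomE"

definition codeg_body :: expr where
  "codeg_body = IfE V1
      (IfE (CallE f_occ [V0, LeftE V1])
        (CallE f_codeg [V0, RightE V1])
        (CellE AtomE (CallE f_codeg [V0, RightE V1])))
      AtomE"

definition leq_body :: expr where
  "leq_body = IfE V0 (IfE V1 (CallE f_leq [RightE V0, RightE V1]) AtomE) TrueE"

definition ins_body :: expr where
  "ins_body = IfE V1
      (IfE (CallE f_leq [CallE f_codeg [RightE V0, V2], CallE f_codeg [RightE (LeftE V1), V2]])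
        (CellE V0 V1)
        (CellE (LeftE V1) (CallE f_ins [V0, RightE V1, V2])))
      (CellE V0 AtomE)"

definition sort_body :: expr where
  "sort_body = IfE V0 (CallE f_ins [LeftE V0, CallE f_sort [RightE V0, V1], V1]) AtomE"

definition sortall_body :: expr where
  "sortall_body = IfE V0 (CellE (CallE f_sort [LeftE V0, V1]) (CallE f_sortall [RightE V0, V1])) AtomE"

definition lib :: "expr list" where
  "lib = [eq_body, mem_body, rem_body, assign_body, holds_body, sat_body, unsat_body, init_body, search_body, branch_body, resample_body, drop_body, mt_body, tails_body, try_body, occ_body, codeg_body, leq_body, ins_body, sort_body, sortall_body]"

lemma call_unfold:
  "call (m # lib) f_eq us = res (m # lib) us eq_body"
  "call (m # lib) f_mem us = res (m # lib) us mem_body"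
  "call (m # lib) f_rem us = res (m # lib) us rem_body"
  "call (m # lib) f_assign us = res (m # lib) us assign_body"
  "call (m # lib) f_holds us = res (m # lib) us holds_body"
  "call (m # lib) f_sat us = res (m # lib) us sat_body"
  "call (m # lib) f_unsat us = res (m # lib) us unsat_body"
  "call (m # lib) f_init us = res (m # lib) us init_body"
  "call (m # lib) f_search us = res (m # lib) us search_body"
  "call (m # lib) f_branch us = res (m # lib) us branch_body"
  "call (m # lib) f_resample us = res (m # lib) us resample_body"
  "call (m # lib) f_drop us = res (m # lib) us drop_body"
  "call (m # lib) f_mt us = res (m # lib) us mt_body"
  "call (m # lib) f_tails us = res (m # lib) us tails_body"
  "call (m # lib) f_try us = res (m # lib) us try_body"
  "call (m # lib) f_occ us = res (m # lib) us occ_body"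
  "call (m # lib) f_codeg us = res (m # lib) us codeg_body"
  "call (m # lib) f_leq us = res (m # lib) us leq_body"
  "call (m # lib) f_ins us = res (m # lib) us ins_body"
  "call (m # lib) f_sort us = res (m # lib) us sort_body"
  "call (m # lib) f_sortall us = res (m # lib) us sortall_body"
  by (simp_all add: call_def lib_def)

lemma length_lib [simp]: "length lib = 21"
  by (simp add: lib_def)


section \<open>Running times and results of the library functions\<close>

abbreviation "enc_clause \<equiv> enc_list enc_literal"

primrec unary :: "nat \<Rightarrow> tree" where
  "unary 0 = Atom"
| "unary (Suc n) = Cell Atom (unary n)"

text \<open>A decoder, which shows \<open>enc_nat\<close> to be injective, so that comparing trees
  decides equality of variables.\<close>

primrec bits_val :: "bool list \<Rightarrow> nat" where
  "bits_val [] = 0"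
| "bits_val (b # bs) = of_bool b + 2 * bits_val bs"

lemma bits_val_bits: "bits_val (bits n) = n"
proof (induction n rule: bits.induct)
  case (1 n)
  show ?case
  proof (cases "n = 0")
    case False
    then have "bits_val (bits n) = of_bool (odd n) + 2 * (n div 2)"
      using 1 by (simp add: bits.simps[of n])
    then show ?thesis by simp
  qed (simp add: bits.simps)
qed

lemma enc_list_eq_iff:
  assumes "\<And>x y. f x = f y \<longleftrightarrow> x = y"
  shows "enc_list f xs = enc_list f ys \<longleftrightarrow> xs = ys"
proof (induction xs arbitrary: ys)
  case Nil
  show ?case by (cases ys) auto
next
  case (Cons x xs)
  then show ?case using assms by (cases ys) auto
qed

lemma enc_bool_simps [simp]:
  "enc_bool b = Atom \<longleftrightarrow> \<not> b" "enc_bool True = Cell Atom Atom" "enc_bool False = Atom"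
  by (auto simp: enc_bool_def)

lemma enc_nat_eq_iff [simp]: "enc_nat x = enc_nat y \<longleftrightarrow> x = y"
proof -
  have "enc_nat x = enc_nat y \<longleftrightarrow> bits x = bits y"
    unfolding enc_nat_def by (rule enc_list_eq_iff) (auto simp: enc_bool_def)
  also have "\<dots> \<longleftrightarrow> x = y" by (metis bits_val_bits)
  finally show ?thesis .
qed

lemma enc_simps [simp]:
  "enc_list f xs = Atom \<longleftrightarrow> xs = []"
  "enc_cnf [] = Atom" "enc_cnf (c # cs) = Cell (enc_clause c) (enc_cnf cs)"
  "enc_cnf cs = Atom \<longleftrightarrow> cs = []"
  "enc_var_list [] = Atom" "enc_var_list (x # s) = Cell (enc_nat x) (enc_var_list s)"
  "left (enc_literal l) = enc_bool (positive l)" "right (enc_literal l) = enc_nat (var l)"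
  "left (enc_list enc_bool r) = enc_bool (coin r)"
  "right (enc_list f xs) = enc_list f (tl xs)"
  by (cases xs; simp add: enc_cnf_def enc_var_list_def; fail
      | cases cs; simp add: enc_cnf_def; fail
      | cases l; simp; fail
      | cases r; simp; fail
      | simp add: enc_cnf_def enc_var_list_def)+

text \<open>Two recursive calls bring two additive constants 20. The 40 steps for the root cell pay
  for the second of them and leave 20 for the body.\<close>

lemma call_eq:
  "gives (call (m # lib) f_eq [u, v]) (enc_bool (u = v)) (40 * size u + 20)"
proof (induction u arbitrary: v)
  case Atom
  show ?case by (subst call_unfold, cases v) (simp_all add: eq_body_def gives_def)
next
  case (Cell u1 u2)
  show ?case
  proof (cases v)
    case Atom
    then show ?thesis by (subst call_unfold) (simp add: eq_body_def gives_def)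
  next
    case v: (Cell v1 v2)
    obtain t1 where t1: "call (m # lib) f_eq [u1, v1] = Some (enc_bool (u1 = v1), t1)"
        "t1 \<le> 40 * size u1 + 20"
      using Cell.IH(1) by (rule givesE)
    obtain t2 where t2: "call (m # lib) f_eq [u2, v2] = Some (enc_bool (u2 = v2), t2)"
        "t2 \<le> 40 * size u2 + 20"
      using Cell.IH(2) by (rule givesE)
    show ?thesis
      using v t1 t2
      by (subst call_unfold, cases "u1 = v1") (simp_all add: eq_body_def gives_def)
  qed
qed

lemma call_mem:
  assumes "40 * size (enc_nat x) + 100 \<le> K"
  shows "gives (call (m # lib) f_mem [enc_nat x, enc_var_list s]) (enc_bool (x \<in> set s))
    ((length s + 1) * K)"
proof (induction s)
  case Nil
  show ?case using assms by (subst call_unfold) (simp add: mem_body_def gives_def)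
next
  case (Cons y s)
  obtain t1 where t1: "call (m # lib) f_eq [enc_nat x, enc_nat y] = Some (enc_bool (x = y), t1)"
      "t1 + 80 \<le> K"
    using call_eq[of m "enc_nat x" "enc_nat y"] assms by (elim givesE) auto
  obtain t2 where t2: "call (m # lib) f_mem [enc_nat x, enc_var_list s]
        = Some (enc_bool (x \<in> set s), t2)" "t2 \<le> (length s + 1) * K"
    using Cons by (rule givesE)
  show ?case
    using t1 t2 by (subst call_unfold, cases "x = y") (simp_all add: mem_body_def gives_def)
qed

lemma call_rem:
  assumes "40 * size (enc_nat x) + 100 \<le> K"
  shows "gives (call (m # lib) f_rem [enc_nat x, enc_var_list s]) (enc_var_list (removeAll x s))
    ((length s + 1) * K)"
proof (induction s)
  case Nil
  show ?case using assms by (subst call_unfold) (simp add: rem_body_def gives_def)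
next
  case (Cons y s)
  obtain t1 where t1: "call (m # lib) f_eq [enc_nat x, enc_nat y] = Some (enc_bool (x = y), t1)"
      "t1 + 80 \<le> K"
    using call_eq[of m "enc_nat x" "enc_nat y"] assms by (elim givesE) auto
  obtain t2 where t2: "call (m # lib) f_rem [enc_nat x, enc_var_list s]
        = Some (enc_var_list (removeAll x s), t2)" "t2 \<le> (length s + 1) * K"
    using Cons by (rule givesE)
  show ?case
    using t1 t2 by (subst call_unfold, cases "x = y") (simp_all add: rem_body_def gives_def)
qed

text \<open>\<open>N\<close> bounds the sizes that come from the formula, \<open>S\<close> the
  length of the list of true variables. They are kept apart because that list may grow during a
  run.\<close>

definition t_mem :: "nat \<Rightarrow> nat \<Rightarrow> nat" where
  "t_mem N S = (S + 1) * (40 * N + 100)"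

lemma mem_bound_le:
  "length s \<le> S \<Longrightarrow> size (enc_nat x) \<le> N \<Longrightarrow>
    (length s + 1) * (40 * size (enc_nat x) + 100) \<le> t_mem N S"
  unfolding t_mem_def by (intro mult_le_mono) auto

lemma call_assign:
  assumes "length s \<le> S" "size (enc_nat x) \<le> N"
  shows "gives (call (m # lib) f_assign [enc_nat x, enc_bool b, enc_var_list s])
    (enc_var_list (assign x b s)) (t_mem N S + 100)"
proof -
  obtain t where t: "call (m # lib) f_rem [enc_nat x, enc_var_list s]
      = Some (enc_var_list (removeAll x s), t)" "t \<le> t_mem N S"
    using call_rem[OF order.refl, of m x s] mem_bound_le[OF assms] by (elim givesE) auto
  show ?thesis
    using t by (subst call_unfold, cases b) (simp_all add: assign_body_def gives_def assign_def)
qed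

lemma call_holds:
  assumes "length s \<le> S" "size (enc_nat (var l)) \<le> N"
  shows "gives (call (m # lib) f_holds [enc_literal l, enc_var_list s])
    (enc_bool (lit_holds (assignment_of s) l)) (t_mem N S + 100)"
proof -
  obtain t where t: "call (m # lib) f_mem [enc_nat (var l), enc_var_list s]
      = Some (enc_bool (var l \<in> set s), t)" "t \<le> t_mem N S"
    using call_mem[OF order.refl, of m "var l" s] mem_bound_le[OF assms] by (elim givesE) auto
  show ?thesis
    using t by (subst call_unfold, cases "positive l"; cases "var l \<in> set s")
      (simp_all add: holds_body_def gives_def lit_holds_iff assignment_of_def)
qed

text \<open>Such a bound passes to tails and to sorted clauses. One \<open>N\<close> therefore
  serves all recursive calls, whereas the size of the argument changes.\<close>

definition short_clause :: "nat \<Rightarrow> literal list \<Rightarrow> bool" where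
  "short_clause N c \<longleftrightarrow> length c \<le> N \<and> (\<forall>l\<in>set c. size (enc_nat (var l)) \<le> N)"

definition short_cnf :: "nat \<Rightarrow> literal list list \<Rightarrow> bool" where
  "short_cnf N cs \<longleftrightarrow> length cs \<le> N \<and> (\<forall>c\<in>set cs. short_clause N c)"

lemma short_clause_Cons:
  "short_clause N (l # c) \<Longrightarrow> short_clause N c"
  "short_clause N (l # c) \<Longrightarrow> size (enc_nat (var l)) \<le> N"
  by (auto simp: short_clause_def)

lemma short_cnf_Cons:
  "short_cnf N (c # cs) \<Longrightarrow> short_cnf N cs"
  "short_cnf N (c # cs) \<Longrightarrow> short_clause N c"
  by (auto simp: short_cnf_def)

definition t_sat :: "nat \<Rightarrow> nat \<Rightarrow> nat" where
  "t_sat N S = (N + 1) * (t_mem N S + 200)"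

lemma call_sat:
  assumes "length s \<le> S" "short_clause N c"
  shows "gives (call (m # lib) f_sat [enc_clause c, enc_var_list s])
    (enc_bool (sat (assignment_of s) c)) (t_sat N S)"
proof -
  define K where "K = t_mem N S + 200"
  have "gives (call (m # lib) f_sat [enc_clause c, enc_var_list s])
      (enc_bool (sat (assignment_of s) c)) ((length c + 1) * K)"
    using assms(2)
  proof (induction c)
    case Nil
    show ?case by (subst call_unfold) (simp add: sat_body_def gives_def sat_def K_def)
  next
    case (Cons l c)
    obtain t1 where t1: "call (m # lib) f_holds [enc_literal l, enc_var_list s]
        = Some (enc_bool (lit_holds (assignment_of s) l), t1)" "t1 + 100 \<le> K"
      using call_holds[OF assms(1) short_clause_Cons(2)[OF Cons.prems], of m]
      unfolding K_def by (elim givesE) auto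
    obtain t2 where t2: "call (m # lib) f_sat [enc_clause c, enc_var_list s]
        = Some (enc_bool (sat (assignment_of s) c), t2)" "t2 \<le> (length c + 1) * K"
      using Cons.IH[OF short_clause_Cons(1)[OF Cons.prems]] by (rule givesE)
    show ?case
      using t1 t2 by (subst call_unfold, cases "lit_holds (assignment_of s) l")
        (simp_all add: sat_body_def gives_def sat_def)
  qed
  moreover have "(length c + 1) * K \<le> t_sat N S"
    unfolding t_sat_def K_def[symmetric]
    by (rule mult_le_mono1) (use assms(2) in \<open>simp add: short_clause_def\<close>)
  ultimately show ?thesis by (rule gives_mono)
qed

definition t_unsat :: "nat \<Rightarrow> nat \<Rightarrow> nat" where
  "t_unsat N S = (N + 1) * (t_sat N S + 200)"

lemma call_unsat:
  assumes "length s \<le> S" "short_cnf N cs"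
  shows "gives (call (m # lib) f_unsat [enc_cnf cs, enc_var_list s])
    (enc_cnf (unsat cs s)) (t_unsat N S)"
proof -
  define K where "K = t_sat N S + 200"
  have "gives (call (m # lib) f_unsat [enc_cnf cs, enc_var_list s])
      (enc_cnf (unsat cs s)) ((length cs + 1) * K)"
    using assms(2)
  proof (induction cs)
    case Nil
    show ?case by (subst call_unfold) (simp add: unsat_body_def gives_def unsat_def K_def)
  next
    case (Cons c cs)
    obtain t1 where t1: "call (m # lib) f_sat [enc_clause c, enc_var_list s]
        = Some (enc_bool (sat (assignment_of s) c), t1)" "t1 + 100 \<le> K"
      using call_sat[OF assms(1) short_cnf_Cons(2)[OF Cons.prems], of m]
      unfolding K_def by (elim givesE) auto
    obtain t2 where t2: "call (m # lib) f_unsat [enc_cnf cs, enc_var_list s]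
        = Some (enc_cnf (unsat cs s), t2)" "t2 \<le> (length cs + 1) * K"
      using Cons.IH[OF short_cnf_Cons(1)[OF Cons.prems]] by (rule givesE)
    show ?case
      using t1 t2 by (subst call_unfold, cases "sat (assignment_of s) c")
        (simp_all add: unsat_body_def gives_def unsat_def)
  qed
  moreover have "(length cs + 1) * K \<le> t_unsat N S"
    unfolding t_unsat_def K_def[symmetric]
    by (rule mult_le_mono1) (use assms(2) in \<open>simp add: short_cnf_def\<close>)
  ultimately show ?thesis by (rule gives_mono)
qed

section \<open>Running times of the initial assignment and the bounded search\<close>

definition initial :: "literal list list \<Rightarrow> nat list" where
  "initial cs = foldr (\<lambda>c. assign (var (hd c)) (positive (hd c))) cs []"

lemma length_assign: "length (assign x b s) \<le> length s + 1"
  by (auto simp: assign_def intro: order.trans[OF length_removeAll_less_eq])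

lemma length_initial: "length (initial cs) \<le> length cs"
proof (induction cs)
  case (Cons c cs)
  then show ?case
    using length_assign[of "var (hd c)" "positive (hd c)" "initial cs"] by (simp add: initial_def)
qed (simp add: initial_def)

definition t_init :: "nat \<Rightarrow> nat" where
  "t_init N = (N + 1) * (t_mem N N + 200)"

lemma call_init:
  assumes "short_cnf N cs" "\<forall>c\<in>set cs. c \<noteq> []"
  shows "gives (call (m # lib) f_init [enc_cnf cs]) (enc_var_list (initial cs)) (t_init N)"
proof -
  define K where "K = t_mem N N + 200"
  have "gives (call (m # lib) f_init [enc_cnf cs]) (enc_var_list (initial cs)) ((length cs + 1) * K)"
    using assms
  proof (induction cs)
    case Nil
    show ?case by (subst call_unfold) (simp add: init_body_def gives_def initial_def K_def)
  next
    case (Cons c cs)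
    then obtain l c' where c: "c = l # c'" by (cases c) auto
    have "\<forall>c\<in>set cs. c \<noteq> []" using Cons.prems(2) by simp
    with Cons.IH short_cnf_Cons(1)[OF Cons.prems(1)]
    have "gives (call (m # lib) f_init [enc_cnf cs]) (enc_var_list (initial cs)) ((length cs + 1) * K)"
      by blast
    then obtain t1 where t1: "call (m # lib) f_init [enc_cnf cs] = Some (enc_var_list (initial cs), t1)"
        "t1 \<le> (length cs + 1) * K"
      by (rule givesE)
    have "length (initial cs) \<le> N"
      using length_initial[of cs] Cons.prems by (simp add: short_cnf_def)
    moreover have "size (enc_nat (var l)) \<le> N"
      using short_cnf_Cons(2)[OF Cons.prems(1)] c by (simp add: short_clause_def)
    ultimately obtain t2 where t2: "call (m # lib) f_assign
        [enc_nat (var l), enc_bool (positive l), enc_var_list (initial cs)]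
        = Some (enc_var_list (assign (var l) (positive l) (initial cs)), t2)"
        "t2 \<le> t_mem N N + 100"
      by (rule givesE[OF call_assign])
    show ?case
      using t1 t2 c
      by (subst call_unfold) (simp_all add: init_body_def gives_def initial_def K_def)
  qed
  moreover have "(length cs + 1) * K \<le> t_init N"
    unfolding t_init_def K_def[symmetric]
    by (rule mult_le_mono1) (use assms(1) in \<open>simp add: short_cnf_def\<close>)
  ultimately show ?thesis by (rule gives_mono)
qed

text \<open>Success needs a tag, as the empty list of true variables is itself encoded as the
  atom.\<close>

primrec enc_result :: "nat list option \<Rightarrow> tree" where
  "enc_result None = Atom"
| "enc_result (Some s) = Cell Atom (enc_var_list s)"

primrec first_some :: "('a \<Rightarrow> 'b option) \<Rightarrow> 'a list \<Rightarrow> 'b option" where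
  "first_some g [] = None"
| "first_some g (x # xs) = (case g x of Some y \<Rightarrow> Some y | None \<Rightarrow> first_some g xs)"

primrec search :: "literal list list \<Rightarrow> nat \<Rightarrow> nat list \<Rightarrow> nat list option" where
  "search cs 0 s = (case unsat cs s of [] \<Rightarrow> Some s | c # _ \<Rightarrow> None)"
| "search cs (Suc d) s = (case unsat cs s of [] \<Rightarrow> Some s
    | c # _ \<Rightarrow> first_some (\<lambda>l. search cs d (assign (var l) (positive l) s)) c)"

text \<open>The growth in \<open>d\<close> is exponential, but for fixed \<open>k\<close> and
  \<open>d\<close> this is a polynomial in \<open>N\<close> and \<open>S\<close>.\<close>

primrec t_search :: "nat \<Rightarrow> nat \<Rightarrow> nat \<Rightarrow> nat \<Rightarrow> nat" where
  "t_search k N S 0 = t_unsat N S + 200"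
| "t_search k N S (Suc d) = t_unsat N S + 200 + (k + 1) * (t_search k N S d + t_mem N S + 300)"

lemma short_cnf_unsat:
  assumes "short_cnf N cs" "unsat cs s = c # ds"
  shows "c \<in> set cs" "short_clause N c"
proof -
  show "c \<in> set cs"
    using unsat_Cons[OF assms(2)] by (auto simp: find_Some_iff)
  with assms(1) show "short_clause N c" by (simp add: short_cnf_def)
qed

text \<open>The invariant is \<open>length s + d\<close> \<le> \<open>S\<close>, since a level adds
  at most one variable to \<open>s\<close>. An inner induction runs through the literals of the
  violated clause.\<close>

lemma call_search:
  assumes "short_cnf N cs" "\<forall>c\<in>set cs. length c \<le> k" "length s + d \<le> S"
  shows "gives (call (m # lib) f_search [enc_cnf cs, enc_var_list s, unary d])
    (enc_result (search cs d s)) (t_search k N S d)"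
  using assms(3)
proof (induction d arbitrary: s)
  case 0
  obtain t where t: "call (m # lib) f_unsat [enc_cnf cs, enc_var_list s] = Some (enc_cnf (unsat cs s), t)"
      "t \<le> t_unsat N S"
    using 0 by (elim givesE[OF call_unsat[OF _ assms(1), of s S m], rotated]) simp_all
  show ?case
    using t by (subst call_unfold, cases "unsat cs s") (simp_all add: search_body_def gives_def)
next
  case (Suc d)
  define K where "K = t_search k N S d + t_mem N S + 300"
  define g where "g = (\<lambda>l. search cs d (assign (var l) (positive l) s))"
  obtain t where t: "call (m # lib) f_unsat [enc_cnf cs, enc_var_list s] = Some (enc_cnf (unsat cs s), t)"
      "t \<le> t_unsat N S"
    using Suc.prems by (elim givesE[OF call_unsat[OF _ assms(1), of s S m], rotated]) simp_all
  have branch: "gives (call (m # lib) f_branch [enc_cnf cs, enc_var_list s, unary d, enc_clause c])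
      (enc_result (first_some g c)) ((length c + 1) * K)" if "short_clause N c" for c
    using that
  proof (induction c)
    case Nil
    show ?case by (subst call_unfold) (simp add: branch_body_def gives_def K_def)
  next
    case (Cons l c)
    let ?s = "assign (var l) (positive l) s"
    have len: "length s \<le> S" using Suc.prems by simp
    obtain t1 where t1: "call (m # lib) f_assign
        [enc_nat (var l), enc_bool (positive l), enc_var_list s] = Some (enc_var_list ?s, t1)"
        "t1 \<le> t_mem N S + 100"
      by (rule givesE[OF call_assign[OF len short_clause_Cons(2)[OF Cons.prems], of m]])
    have "length ?s + d \<le> S"
      using length_assign[of "var l" "positive l" s] Suc.prems by simp
    then obtain t2 where t2: "call (m # lib) f_search [enc_cnf cs, enc_var_list ?s, unary d]
        = Some (enc_result (g l), t2)" "t2 \<le> t_search k N S d"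
      unfolding g_def by (rule givesE[OF Suc.IH])
    obtain t3 where t3: "call (m # lib) f_branch [enc_cnf cs, enc_var_list s, unary d, enc_clause c]
        = Some (enc_result (first_some g c), t3)" "t3 \<le> (length c + 1) * K"
      by (rule givesE[OF Cons.IH[OF short_clause_Cons(1)[OF Cons.prems]]])
    have "t1 + t2 + 200 \<le> K" using t1 t2 by (simp add: K_def)
    then show ?case
      using t1(1) t2(1) t3
      by (subst call_unfold, cases "g l") (simp_all add: branch_body_def gives_def)
  qed
  show ?case
  proof (cases "unsat cs s")
    case Nil
    then show ?thesis using t by (subst call_unfold) (simp add: search_body_def gives_def)
  next
    case (Cons c ds)
    obtain t2 where t2: "call (m # lib) f_branch [enc_cnf cs, enc_var_list s, unary d, enc_clause c]
        = Some (enc_result (first_some g c), t2)" "t2 \<le> (length c + 1) * K"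
      by (rule givesE[OF branch[OF short_cnf_unsat(2)[OF assms(1) Cons]]])
    have "length c \<le> k" using short_cnf_unsat(1)[OF assms(1) Cons] assms(2) by simp
    then have "(length c + 1) * K \<le> (k + 1) * K" by (intro mult_le_mono1) simp
    then have "t2 \<le> (k + 1) * K" using t2(2) by linarith
    then have "t + t2 + 200 \<le> t_search k N S (Suc d)"
      using t(2) unfolding t_search.simps K_def[symmetric] by linarith
    then show ?thesis
      using t(1) t2(1) Cons
      by (subst call_unfold) (simp add: search_body_def gives_def g_def del: t_search.simps)
  qed
qed

section \<open>Running times of resampling and of trying all truncations\<close>

lemma call_drop:
  "gives (call (m # lib) f_drop [enc_clause c, enc_list enc_bool r])
    (enc_list enc_bool (drop (length c) r)) ((length c + 1) * 100)"
proof (induction c arbitrary: r)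
  case Nil
  show ?case by (subst call_unfold) (simp add: drop_body_def gives_def)
next
  case (Cons l c)
  obtain t where t: "call (m # lib) f_drop [enc_clause c, enc_list enc_bool (tl r)]
      = Some (enc_list enc_bool (drop (length c) (tl r)), t)" "t \<le> (length c + 1) * 100"
    using Cons.IH by (rule givesE)
  have "drop (length (l # c)) r = drop (length c) (tl r)" by (cases r) simp_all
  then show ?case
    using t by (subst call_unfold) (simp add: drop_body_def gives_def del: drop_Suc)
qed

definition t_resample :: "nat \<Rightarrow> nat \<Rightarrow> nat" where
  "t_resample N S = (N + 1) * (t_mem N S + 300)"

lemma length_resample: "length (resample c r s) \<le> length s + length c"
proof (induction c arbitrary: r s)
  case (Cons l c)
  show ?case
    using Cons.IH[of "tl r" "assign (var l) (coin r) s"] length_assign[of "var l" "coin r" s] by simp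
qed simp

lemma call_resample:
  assumes "length s + length c \<le> S" "short_clause N c"
  shows "gives (call (m # lib) f_resample [enc_clause c, enc_list enc_bool r, enc_var_list s])
    (enc_var_list (resample c r s)) (t_resample N S)"
proof -
  define K where "K = t_mem N S + 300"
  have "gives (call (m # lib) f_resample [enc_clause c, enc_list enc_bool r, enc_var_list s])
    (enc_var_list (resample c r s)) ((length c + 1) * K)"
    using assms
  proof (induction c arbitrary: r s)
    case Nil
    show ?case by (subst call_unfold) (simp add: resample_body_def gives_def K_def)
  next
    case (Cons l c)
    let ?s = "assign (var l) (coin r) s"
    have len: "length s \<le> S" using Cons.prems by simp
    obtain t1 where t1: "call (m # lib) f_assign
        [enc_nat (var l), enc_bool (coin r), enc_var_list s] = Some (enc_var_list ?s, t1)"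
        "t1 \<le> t_mem N S + 100"
      by (rule givesE[OF call_assign[OF len short_clause_Cons(2)[OF Cons.prems(2)], of m]])
    have "length ?s + length c \<le> S"
      using length_assign[of "var l" "coin r" s] Cons.prems by simp
    then obtain t2 where t2: "call (m # lib) f_resample
        [enc_clause c, enc_list enc_bool (tl r), enc_var_list ?s]
        = Some (enc_var_list (resample c (tl r) ?s), t2)" "t2 \<le> (length c + 1) * K"
      using short_clause_Cons(1)[OF Cons.prems(2)] by (rule givesE[OF Cons.IH])
    have "t1 + 200 \<le> K" using t1 by (simp add: K_def)
    then show ?case
      using t1(1) t2 by (subst call_unfold) (simp add: resample_body_def gives_def)
  qed
  moreover have "(length c + 1) * K \<le> t_resample N S"
    unfolding t_resample_def K_def[symmetric]
    by (rule mult_le_mono1) (use assms(2) in \<open>simp add: short_clause_def\<close>)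
  ultimately show ?thesis by (rule gives_mono)
qed

definition t_step :: "nat \<Rightarrow> nat \<Rightarrow> nat" where
  "t_step N S = t_unsat N S + t_resample N S + (N + 1) * 100 + 200"

text \<open>The invariant charges \<open>N\<close> list entries to every coin: a step adds at most
  \<open>length c\<close> \<le> \<open>N\<close> variables and uses at least one coin.\<close>

lemma call_mt:
  assumes "short_cnf N cs" "length s + N * length r \<le> S"
  shows "gives (call (m # lib) f_mt [enc_cnf cs, enc_var_list s, enc_list enc_bool r])
    (enc_result (mt cs s r)) ((length r + 1) * t_step N S)"
  using assms
proof (induction cs s r rule: mt.induct)
  case (1 cs s r)
  obtain t where t: "call (m # lib) f_unsat [enc_cnf cs, enc_var_list s] = Some (enc_cnf (unsat cs s), t)"
      "t \<le> t_unsat N S"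
    using 1(3) by (elim givesE[OF call_unsat[OF _ 1(2), of s S m], rotated]) simp_all
  have step: "t + 200 \<le> t_step N S" using t by (simp add: t_step_def)
  show ?case
  proof (cases "unsat cs s")
    case Nil
    then show ?thesis
      using t(1) step by (subst call_unfold) (simp add: mt_body_def gives_def mt.simps[of cs s r])
  next
    case (Cons c ds)
    note c = short_cnf_unsat[OF 1(2) Cons]
    show ?thesis
    proof (cases "c = [] \<or> r = []")
      case True
      then show ?thesis
        using Cons t(1) step
        by (subst call_unfold) (auto simp add: mt_body_def gives_def mt.simps[of cs s r])
    next
      case False
      let ?s = "resample c r s" and ?r = "drop (length c) r"
      have "length c \<le> N" using c by (simp add: short_clause_def)
      have r: "1 \<le> length r" "1 \<le> length c" using False by (cases r; cases c; simp)+
      have "N \<le> N * length r" using mult_le_mono2[OF r(1), of N] by simp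
      with 1(3) \<open>length c \<le> N\<close> have "length s + length c \<le> S" by linarith
      then obtain t1 where t1: "call (m # lib) f_resample
          [enc_clause c, enc_list enc_bool r, enc_var_list s] = Some (enc_var_list ?s, t1)"
          "t1 \<le> t_resample N S"
        using c(2) by (rule givesE[OF call_resample])
      obtain t2 where t2: "call (m # lib) f_drop [enc_clause c, enc_list enc_bool r]
          = Some (enc_list enc_bool ?r, t2)" "t2 \<le> (length c + 1) * 100"
        by (rule givesE[OF call_drop])
      have "N * length ?r \<le> N * (length r - 1)" using r by (intro mult_le_mono2) simp
      moreover have "N * length r = N * (length r - 1) + N"
        using r by (cases "length r") simp_all
      ultimately have "length ?s + N * length ?r \<le> S"
        using length_resample[of c r s] 1(3) \<open>length c \<le> N\<close> by linarith
      then obtain t3 where t3: "call (m # lib) f_mt [enc_cnf cs, enc_var_list ?s, enc_list enc_bool ?r]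
          = Some (enc_result (mt cs ?s ?r), t3)" "t3 \<le> (length ?r + 1) * t_step N S"
        by (rule givesE[OF 1(1)[OF Cons False 1(2)]])
      have "(length ?r + 1) * t_step N S \<le> length r * t_step N S"
        using r by (intro mult_le_mono1) simp
      then have "t3 \<le> length r * t_step N S" using t3 by linarith
      moreover have "t + t1 + t2 + 200 \<le> t_step N S"
        using t(2) t1(2) t2(2) \<open>length c \<le> N\<close> by (simp add: t_step_def)
      ultimately show ?thesis
        using False Cons t(1) t1(1) t2(1) t3(1)
        by (subst call_unfold) (simp add: mt_body_def gives_def mt.simps[of cs s r])
    qed
  qed
qed

lemma call_tails:
  "gives (call (m # lib) f_tails [enc_cnf cs]) (enc_cnf (map tl cs)) ((length cs + 1) * 100)"
proof (induction cs)
  case Nil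
  show ?case by (subst call_unfold) (simp add: tails_body_def gives_def)
next
  case (Cons c cs)
  obtain t where t: "call (m # lib) f_tails [enc_cnf cs] = Some (enc_cnf (map tl cs), t)"
      "t \<le> (length cs + 1) * 100"
    using Cons.IH by (rule givesE)
  then show ?case by (subst call_unfold) (simp add: tails_body_def gives_def)
qed

text \<open>The clauses it is applied to have equal lengths, so the first one tells when all are
  used up. Coins and starting list are the same for every truncation.\<close>

function try_tails :: "literal list list \<Rightarrow> nat list \<Rightarrow> bool list \<Rightarrow> nat list option" where
  "try_tails cs s r = (case mt cs s r of Some s' \<Rightarrow> Some s'
     | None \<Rightarrow> if cs = [] \<or> hd cs = [] then None else try_tails (map tl cs) s r)"
  by pat_completeness auto
termination by (relation "measure (\<lambda>(cs, s, r). length (hd cs))") (auto simp: hd_map)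

declare try_tails.simps [simp del]

definition t_try :: "nat \<Rightarrow> nat \<Rightarrow> nat \<Rightarrow> nat" where
  "t_try N S R = (R + 1) * t_step N S + (N + 1) * 100 + 200"

lemma short_clause_tl: "short_clause N c \<Longrightarrow> short_clause N (tl c)"
  by (cases c) (auto simp: short_clause_def)

lemma short_cnf_tails: "short_cnf N cs \<Longrightarrow> short_cnf N (map tl cs)"
  unfolding short_cnf_def by (auto intro: short_clause_tl)

lemma left_enc_cnf: "left (enc_cnf cs) = Atom \<longleftrightarrow> cs = [] \<or> hd cs = []"
  by (cases cs) simp_all

definition width :: "literal list list \<Rightarrow> nat" where
  "width cs = (if cs = [] then 0 else length (hd cs))"

lemma call_try:
  assumes "short_cnf N cs" "length s + N * length r \<le> S"
  shows "gives (call (m # lib) f_try [enc_cnf cs, enc_var_list s, enc_list enc_bool r])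
    (enc_result (try_tails cs s r)) ((width cs + 1) * t_try N S (length r))"
  using assms
proof (induction cs s r rule: try_tails.induct)
  case (1 cs s r)
  obtain t where t: "call (m # lib) f_mt [enc_cnf cs, enc_var_list s, enc_list enc_bool r]
      = Some (enc_result (mt cs s r), t)" "t \<le> (length r + 1) * t_step N S"
    by (rule givesE[OF call_mt[OF 1(2,3)]])
  then have step: "t + 200 \<le> t_try N S (length r)" by (simp add: t_try_def)
  show ?case
  proof (cases "mt cs s r")
    case (Some s')
    then show ?thesis
      using t(1) step
      by (subst call_unfold) (simp add: try_body_def gives_def try_tails.simps[of cs s r])
  next
    case None
    show ?thesis
    proof (cases "cs = [] \<or> hd cs = []")
      case True
      then show ?thesis
        using t(1) step None
        by (subst call_unfold)
          (simp add: try_body_def gives_def try_tails.simps[of cs s r] left_enc_cnf)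
    next
      case False
      obtain t2 where t2: "call (m # lib) f_tails [enc_cnf cs] = Some (enc_cnf (map tl cs), t2)"
          "t2 \<le> (length cs + 1) * 100"
        by (rule givesE[OF call_tails])
      obtain t3 where t3: "call (m # lib) f_try
          [enc_cnf (map tl cs), enc_var_list s, enc_list enc_bool r]
          = Some (enc_result (try_tails (map tl cs) s r), t3)"
          "t3 \<le> (width (map tl cs) + 1) * t_try N S (length r)"
        by (rule givesE[OF 1(1)[OF None False short_cnf_tails[OF 1(2)] 1(3)]])
      have "width (map tl cs) + 1 = width cs" using False by (simp add: hd_map width_def)
      then have t3': "t3 \<le> width cs * t_try N S (length r)" using t3(2) by simp
      have "length cs \<le> N" using 1(2) by (simp add: short_cnf_def)
      then have "t + t2 + 200 \<le> t_try N S (length r)"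
        using t(2) t2(2) by (simp add: t_try_def)
      then show ?thesis
        using False None t(1) t2(1) t3(1) t3'
        by (subst call_unfold)
          (simp add: try_body_def gives_def try_tails.simps[of cs s r] left_enc_cnf)
    qed
  qed
qed

text \<open>Ascending order by codegree is descending order by degree, so \<^const>\<open>tl\<close> removes a most
  frequent variable.\<close>

definition codegree :: "literal list list \<Rightarrow> nat \<Rightarrow> nat" where
  "codegree cs x = length (filter (\<lambda>c. x \<notin> cvars c) cs)"

definition t_occ :: "nat \<Rightarrow> nat" where
  "t_occ N = (N + 1) * (40 * N + 200)"

lemma call_occ:
  assumes "size (enc_nat x) \<le> N" "short_clause N c"
  shows "gives (call (m # lib) f_occ [enc_nat x, enc_clause c]) (enc_bool (x \<in> cvars c)) (t_occ N)"
proof -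
  define K where "K = 40 * N + 200"
  have "gives (call (m # lib) f_occ [enc_nat x, enc_clause c]) (enc_bool (x \<in> cvars c))
      ((length c + 1) * K)"
  proof (induction c)
    case Nil
    show ?case by (subst call_unfold) (simp add: occ_body_def gives_def cvars_def K_def)
  next
    case (Cons l c)
    obtain t1 where t1: "call (m # lib) f_eq [enc_nat x, enc_nat (var l)]
        = Some (enc_bool (x = var l), t1)" "t1 \<le> 40 * size (enc_nat x) + 20"
      using call_eq[of m "enc_nat x" "enc_nat (var l)"] by (elim givesE) auto
    then have "t1 + 100 \<le> K" using assms(1) by (simp add: K_def)
    obtain t2 where t2: "call (m # lib) f_occ [enc_nat x, enc_clause c]
        = Some (enc_bool (x \<in> cvars c), t2)" "t2 \<le> (length c + 1) * K"
      using Cons.IH by (rule givesE)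
    have "x \<in> cvars (l # c) \<longleftrightarrow> x = var l \<or> x \<in> cvars c" by (auto simp: cvars_def)
    then show ?case
      using t1(1) \<open>t1 + 100 \<le> K\<close> t2
      by (subst call_unfold, cases "x = var l") (simp_all add: occ_body_def gives_def)
  qed
  moreover have "(length c + 1) * K \<le> t_occ N"
    unfolding t_occ_def K_def[symmetric]
    by (rule mult_le_mono1) (use assms(2) in \<open>simp add: short_clause_def\<close>)
  ultimately show ?thesis by (rule gives_mono)
qed

definition t_codeg :: "nat \<Rightarrow> nat" where
  "t_codeg N = (N + 1) * (t_occ N + 100)"

lemma call_codeg:
  assumes "size (enc_nat x) \<le> N" "short_cnf N cs"
  shows "gives (call (m # lib) f_codeg [enc_nat x, enc_cnf cs]) (unary (codegree cs x)) (t_codeg N)"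
proof -
  define K where "K = t_occ N + 100"
  have "gives (call (m # lib) f_codeg [enc_nat x, enc_cnf cs]) (unary (codegree cs x))
      ((length cs + 1) * K)"
    using assms(2)
  proof (induction cs)
    case Nil
    show ?case by (subst call_unfold) (simp add: codeg_body_def gives_def codegree_def K_def)
  next
    case (Cons c cs)
    obtain t1 where t1: "call (m # lib) f_occ [enc_nat x, enc_clause c]
        = Some (enc_bool (x \<in> cvars c), t1)" "t1 \<le> t_occ N"
      by (rule givesE[OF call_occ[OF assms(1) short_cnf_Cons(2)[OF Cons.prems]]])
    then have "t1 + 100 \<le> K" by (simp add: K_def)
    obtain t2 where t2: "call (m # lib) f_codeg [enc_nat x, enc_cnf cs]
        = Some (unary (codegree cs x), t2)" "t2 \<le> (length cs + 1) * K"
      by (rule givesE[OF Cons.IH[OF short_cnf_Cons(1)[OF Cons.prems]]])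
    show ?case
      using t1(1) \<open>t1 + 100 \<le> K\<close> t2
      by (subst call_unfold, cases "x \<in> cvars c")
        (simp_all add: codeg_body_def gives_def codegree_def)
  qed
  moreover have "(length cs + 1) * K \<le> t_codeg N"
    unfolding t_codeg_def K_def[symmetric]
    by (rule mult_le_mono1) (use assms(2) in \<open>simp add: short_cnf_def\<close>)
  ultimately show ?thesis by (rule gives_mono)
qed

lemma call_leq:
  "gives (call (m # lib) f_leq [unary i, unary j]) (enc_bool (i \<le> j)) ((i + 1) * 100)"
proof (induction i arbitrary: j)
  case 0
  show ?case by (subst call_unfold) (simp add: leq_body_def gives_def)
next
  case (Suc i)
  show ?case
  proof (cases j)
    case 0
    then show ?thesis by (subst call_unfold) (simp add: leq_body_def gives_def)
  next
    case j: (Suc j')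
    obtain t where "call (m # lib) f_leq [unary i, unary j'] = Some (enc_bool (i \<le> j'), t)"
        "t \<le> (i + 1) * 100"
      using Suc.IH by (rule givesE)
    then show ?thesis using j by (subst call_unfold) (simp add: leq_body_def gives_def)
  qed
qed

abbreviation "codegree_key cs \<equiv> \<lambda>l. codegree cs (var l)"

definition t_ins :: "nat \<Rightarrow> nat" where
  "t_ins N = (N + 1) * (2 * t_codeg N + (N + 1) * 100 + 200)"

lemma codegree_le: "short_cnf N cs \<Longrightarrow> codegree cs x \<le> N"
  unfolding codegree_def short_cnf_def by (meson length_filter_le order.trans)

lemma call_ins:
  assumes cs: "short_cnf N cs" and l: "size (enc_nat (var l)) \<le> N" and c: "short_clause N c"
  shows "gives (call (m # lib) f_ins [enc_literal l, enc_clause c, enc_cnf cs])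
    (enc_clause (insort_key (codegree_key cs) l c)) (t_ins N)"
proof -
  define K where "K = 2 * t_codeg N + (N + 1) * 100 + 200"
  have "gives (call (m # lib) f_ins [enc_literal l, enc_clause c, enc_cnf cs])
      (enc_clause (insort_key (codegree_key cs) l c)) ((length c + 1) * K)"
    using c
  proof (induction c)
    case Nil
    show ?case by (subst call_unfold) (simp add: ins_body_def gives_def K_def)
  next
    case (Cons k c)
    obtain t1 where t1: "call (m # lib) f_codeg [enc_nat (var l), enc_cnf cs]
        = Some (unary (codegree cs (var l)), t1)" "t1 \<le> t_codeg N"
      by (rule givesE[OF call_codeg[OF l cs]])
    obtain t2 where t2: "call (m # lib) f_codeg [enc_nat (var k), enc_cnf cs]
        = Some (unary (codegree cs (var k)), t2)" "t2 \<le> t_codeg N"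
      by (rule givesE[OF call_codeg[OF short_clause_Cons(2)[OF Cons.prems] cs]])
    obtain t3 where t3: "call (m # lib) f_leq [unary (codegree cs (var l)), unary (codegree cs (var k))]
        = Some (enc_bool (codegree cs (var l) \<le> codegree cs (var k)), t3)"
        "t3 \<le> (codegree cs (var l) + 1) * 100"
      by (rule givesE[OF call_leq])
    obtain t4 where t4: "call (m # lib) f_ins [enc_literal l, enc_clause c, enc_cnf cs]
        = Some (enc_clause (insort_key (codegree_key cs) l c), t4)" "t4 \<le> (length c + 1) * K"
      by (rule givesE[OF Cons.IH[OF short_clause_Cons(1)[OF Cons.prems]]])
    have "t1 + t2 + t3 + 200 \<le> K"
      using t1 t2 t3 codegree_le[OF cs, of "var l"] by (simp add: K_def)
    then show ?case
      using t1(1) t2(1) t3(1) t4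
      by (subst call_unfold, cases "codegree cs (var l) \<le> codegree cs (var k)")
        (simp_all add: ins_body_def gives_def)
  qed
  moreover have "(length c + 1) * K \<le> t_ins N"
    unfolding t_ins_def K_def[symmetric]
    by (rule mult_le_mono1) (use c in \<open>simp add: short_clause_def\<close>)
  ultimately show ?thesis by (rule gives_mono)
qed

definition t_sort :: "nat \<Rightarrow> nat" where
  "t_sort N = (N + 1) * (t_ins N + 100)"

lemma short_clause_sort: "short_clause N c \<Longrightarrow> short_clause N (sort_key f c)"
  by (simp add: short_clause_def)

lemma call_sort:
  assumes cs: "short_cnf N cs" and c: "short_clause N c"
  shows "gives (call (m # lib) f_sort [enc_clause c, enc_cnf cs])
    (enc_clause (sort_key (codegree_key cs) c)) (t_sort N)"
proof -
  define K where "K = t_ins N + 100"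
  have "gives (call (m # lib) f_sort [enc_clause c, enc_cnf cs])
      (enc_clause (sort_key (codegree_key cs) c)) ((length c + 1) * K)"
    using c
  proof (induction c)
    case Nil
    show ?case by (subst call_unfold) (simp add: sort_body_def gives_def K_def)
  next
    case (Cons l c)
    note c = short_clause_Cons[OF Cons.prems]
    obtain t1 where t1: "call (m # lib) f_sort [enc_clause c, enc_cnf cs]
        = Some (enc_clause (sort_key (codegree_key cs) c), t1)" "t1 \<le> (length c + 1) * K"
      by (rule givesE[OF Cons.IH[OF c(1)]])
    obtain t2 where t2: "call (m # lib) f_ins
        [enc_literal l, enc_clause (sort_key (codegree_key cs) c), enc_cnf cs]
        = Some (enc_clause (sort_key (codegree_key cs) (l # c)), t2)" "t2 \<le> t_ins N"
      using givesE[OF call_ins[OF cs c(2) short_clause_sort[OF c(1)]], of m] by auto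
    have "t2 + 100 \<le> K" using t2 by (simp add: K_def)
    then show ?case
      using t1 t2(1) by (subst call_unfold) (simp add: sort_body_def gives_def)
  qed
  moreover have "(length c + 1) * K \<le> t_sort N"
    unfolding t_sort_def K_def[symmetric]
    by (rule mult_le_mono1) (use c in \<open>simp add: short_clause_def\<close>)
  ultimately show ?thesis by (rule gives_mono)
qed

definition t_sortall :: "nat \<Rightarrow> nat" where
  "t_sortall N = (N + 1) * (t_sort N + 100)"

lemma call_sortall:
  assumes cs: "short_cnf N cs" and ds: "short_cnf N ds"
  shows "gives (call (m # lib) f_sortall [enc_cnf ds, enc_cnf cs])
    (enc_cnf (map (sort_key (codegree_key cs)) ds)) (t_sortall N)"
proof -
  define K where "K = t_sort N + 100"
  have "gives (call (m # lib) f_sortall [enc_cnf ds, enc_cnf cs])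
      (enc_cnf (map (sort_key (codegree_key cs)) ds)) ((length ds + 1) * K)"
    using ds
  proof (induction ds)
    case Nil
    show ?case by (subst call_unfold) (simp add: sortall_body_def gives_def K_def)
  next
    case (Cons c ds)
    obtain t1 where t1: "call (m # lib) f_sort [enc_clause c, enc_cnf cs]
        = Some (enc_clause (sort_key (codegree_key cs) c), t1)" "t1 \<le> t_sort N"
      by (rule givesE[OF call_sort[OF cs short_cnf_Cons(2)[OF Cons.prems]]])
    obtain t2 where t2: "call (m # lib) f_sortall [enc_cnf ds, enc_cnf cs]
        = Some (enc_cnf (map (sort_key (codegree_key cs)) ds), t2)" "t2 \<le> (length ds + 1) * K"
      by (rule givesE[OF Cons.IH[OF short_cnf_Cons(1)[OF Cons.prems]]])
    have "t1 + 100 \<le> K" using t1 by (simp add: K_def)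
    then show ?case
      using t1(1) t2 by (subst call_unfold) (simp add: sortall_body_def gives_def)
  qed
  moreover have "(length ds + 1) * K \<le> t_sortall N"
    unfolding t_sortall_def K_def[symmetric]
    by (rule mult_le_mono1) (use ds in \<open>simp add: short_cnf_def\<close>)
  ultimately show ?thesis by (rule gives_mono)
qed

section \<open>Formulas and their listings\<close>

lemma lists_cnf_exists:
  assumes "finite F" "\<forall>C\<in>F. finite C"
  shows "\<exists>cs. lists_cnf cs F"
proof -
  have "\<forall>C. \<exists>c. C \<in> F \<longrightarrow> set c = C \<and> distinct c"
    using assms(2) finite_distinct_list by blast
  then obtain f where f: "\<And>C. C \<in> F \<Longrightarrow> set (f C) = C \<and> distinct (f C)" by metis
  obtain Cs where Cs: "set Cs = F" "distinct Cs" using assms(1) finite_distinct_list by blast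
  have "map (\<lambda>C. set (f C)) Cs = Cs" using f Cs by (intro map_idI) auto
  then have "map set (map f Cs) = Cs" by (simp add: o_def)
  then have "lists_cnf (map f Cs) F" unfolding lists_cnf_def using Cs f by auto
  then show ?thesis ..
qed

lemma satisfies_lists: "lists_cnf cs F \<Longrightarrow> satisfies a F \<longleftrightarrow> (\<forall>c\<in>set cs. sat a c)"
  by (auto simp: lists_cnf_def satisfies_def sat_def)

lemma cvars_eq: "cvars c = clause_vars (set c)"
  by (simp add: cvars_def clause_vars_def)

lemma lists_cnf_clause:
  assumes "lists_cnf cs F" "k_cnf k F" "c \<in> set cs"
  shows "set c \<in> F" "length c = k" "distinct (map var c)" "distinct c"
proof -
  show "set c \<in> F" "distinct c" using assms by (auto simp: lists_cnf_def)
  then show "length c = k" "distinct (map var c)"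
    using assms(2) by (auto simp: k_cnf_def distinct_map distinct_card[symmetric])
qed

lemma lists_cnf_inj: "lists_cnf cs F \<Longrightarrow> inj_on set (set cs)"
  by (simp add: lists_cnf_def distinct_map)

lemma lists_cnf_length_filter:
  assumes "lists_cnf cs F"
  shows "card {C \<in> F. P C} = length (filter (\<lambda>c. P (set c)) cs)"
proof -
  have "{C \<in> F. P C} = set (filter P (map set cs))" using assms by (auto simp: lists_cnf_def)
  moreover have "distinct (map set cs)" using assms by (simp add: lists_cnf_def)
  then have "distinct (filter P (map set cs))" by (rule distinct_filter)
  ultimately have "card {C \<in> F. P C} = length (filter P (map set cs))"
    by (simp only: distinct_card)
  also have "\<dots> = length (filter (\<lambda>c. P (set c)) cs)" by (simp add: filter_map o_def)
  finally show ?thesis .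
qed

lemma codegree_occurrences:
  assumes "lists_cnf cs F"
  shows "card (occurrences F x) + codegree cs x = length cs"
  unfolding occurrences_def lists_cnf_length_filter[OF assms] codegree_def cvars_eq
  by (rule sum_length_filter_compl)

lemma size_enc_list:
  "length xs \<le> size (enc_list f xs)" "x \<in> set xs \<Longrightarrow> size (f x) \<le> size (enc_list f xs)"
  by (induction xs) auto

lemma size_enc_literal: "size (enc_nat (var l)) \<le> size (enc_literal l)"
  by (cases l) simp_all

lemma short_cnf_input_size: "short_cnf (input_size cs) cs"
proof -
  have "short_clause (input_size cs) c" if "c \<in> set cs" for c
  proof -
    have c: "size (enc_clause c) \<le> input_size cs"
      using size_enc_list(2)[OF that] by (simp add: input_size_def enc_cnf_def)
    have "size (enc_nat (var l)) \<le> size (enc_clause c)" if "l \<in> set c" for l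
      using size_enc_list(2)[OF that, of enc_literal] size_enc_literal[of l] by simp
    then show ?thesis
      using c size_enc_list(1)[of c enc_literal] unfolding short_clause_def by force
  qed
  then show ?thesis
    using size_enc_list(1)[of cs enc_clause]
    by (simp add: short_cnf_def input_size_def enc_cnf_def)
qed

section \<open>Disjoint clauses and the initial assignment\<close>

lemma initial_head:
  assumes "c \<in> set cs" "\<forall>d\<in>set cs. d \<noteq> c \<longrightarrow> var (hd d) \<noteq> var (hd c)"
  shows "assignment_of (initial cs) (var (hd c)) = positive (hd c)"
  using assms
proof (induction cs)
  case (Cons d cs)
  then show ?case
    by (cases "d = c") (auto simp: initial_def assignment_of_assign)
qed simp

lemma initial_sat:
  assumes "c \<in> set cs" "\<forall>d\<in>set cs. d \<noteq> []" "\<forall>d\<in>set cs. d \<noteq> c \<longrightarrow> cvars d \<inter> cvars c = {}"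
  shows "sat (assignment_of (initial cs)) c"
proof -
  have head: "var (hd d) \<in> cvars d" if "d \<in> set cs" for d
    using assms(2) that by (simp add: cvars_def)
  have "\<forall>d\<in>set cs. d \<noteq> c \<longrightarrow> var (hd d) \<noteq> var (hd c)"
    using head assms(1,3) by (metis IntI empty_iff)
  then have "lit_holds (assignment_of (initial cs)) (hd c)"
    using initial_head[OF assms(1)] by (simp add: lit_holds_iff)
  then show ?thesis using assms(1,2) unfolding sat_def by (meson hd_in_set)
qed

definition isolated :: "cnf \<Rightarrow> clause \<Rightarrow> bool" where
  "isolated F C \<longleftrightarrow> (\<forall>D\<in>F. D \<noteq> C \<longrightarrow> clause_vars C \<inter> clause_vars D = {})"

lemma initial_sat_isolated:
  assumes cs: "lists_cnf cs F" "k_cnf k F" "k > 0" and c: "c \<in> set cs" "isolated F (set c)"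
  shows "sat (assignment_of (initial cs)) c"
proof (rule initial_sat[OF c(1)])
  show "\<forall>d\<in>set cs. d \<noteq> []" using lists_cnf_clause(2)[OF cs(1,2)] cs(3) by force
  show "\<forall>d\<in>set cs. d \<noteq> c \<longrightarrow> cvars d \<inter> cvars c = {}"
  proof (intro ballI impI)
    fix d assume d: "d \<in> set cs" "d \<noteq> c"
    then have "set d \<noteq> set c" using lists_cnf_inj[OF cs(1)] c(1) by (meson inj_onD)
    then show "cvars d \<inter> cvars c = {}"
      using c(2) lists_cnf_clause(1)[OF cs(1,2) d(1)] unfolding isolated_def cvars_eq by blast
  qed
qed

section \<open>Truncated clauses\<close>

lemma drop_vars_disjoint:
  assumes "distinct (map var c)"
  shows "var ` set (drop n c) = var ` set c - var ` set (take n c)"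
proof -
  have "set c = set (take n c) \<union> set (drop n c)" by (metis append_take_drop_id set_append)
  then have "var ` set c = var ` set (take n c) \<union> var ` set (drop n c)" by auto
  moreover have "distinct (map var (take n c) @ map var (drop n c))"
    using assms by (simp add: map_append[symmetric] del: map_append)
  then have "var ` set (take n c) \<inter> var ` set (drop n c) = {}" by simp
  ultimately show ?thesis by blast
qed

text \<open>The degrees are those in the full formula and are not updated as variables disappear. So
  one sorting serves every \<open>j\<close>, and repeated \<open>tl\<close> yields all
  truncations.\<close>

definition truncation :: "nat \<Rightarrow> literal list list \<Rightarrow> literal list list" where
  "truncation j cs = map (\<lambda>c. drop j (sort_key (codegree_key cs) c)) cs"

text \<open>Transfers \<open>truncated_degree_le\<close> to lists, with \<open>S C\<close> the
  variables of the first \<open>\<alpha>\<close> literals after sorting. Truncations of different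
  clauses may coincide, which can only lower the count; hence the comparison is by an image and not
  by a bijection.\<close>

lemma truncation_degree:
  assumes pos: "k > 0" "\<alpha> > 0" and F: "small_intersecting k \<alpha> F" and base: "bound_base k \<alpha> \<ge> 1"
    and cs: "lists_cnf cs F"
  shows "real (card {c \<in> set (truncation \<alpha> cs). x \<in> cvars c}) \<le> bound_base k \<alpha>"
proof -
  have F': "k_cnf k F" using F by (simp add: small_intersecting_def)
  \<comment> \<open>Recovers the listing of a clause from its set of literals, as \<open>set\<close>
    is injective on the members of \<open>cs\<close>.\<close>
  define lst where "lst = (\<lambda>C. sort_key (codegree_key cs) (inv_into (set cs) set C))"
  have lst_set: "lst (set c) = sort_key (codegree_key cs) c" if "c \<in> set cs" for c
    unfolding lst_def using lists_cnf_inj[OF cs] that by simp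
  have lst: "set (lst C) = C \<and> length (lst C) = k \<and> distinct (map var (lst C))
      \<and> sorted (map (codegree_key cs) (lst C))" if "C \<in> F" for C
  proof -
    from cs that have "C \<in> set ` set cs" by (auto simp: lists_cnf_def)
    then obtain c where c: "c \<in> set cs" "C = set c" by blast
    note l = lists_cnf_clause[OF cs F' c(1)]
    have "inj_on var (set (lst C))" using l c lst_set[OF c(1)] by (simp add: distinct_map)
    then show ?thesis using l c lst_set[OF c(1)] by (simp add: distinct_map)
  qed
  define S where "S = (\<lambda>C. var ` set (take \<alpha> (lst C)))"
  have \<alpha>: "\<alpha> \<le> k" using bound_base_ge_1_imp[OF pos base] by simp
  have drop: "var ` set (drop \<alpha> (lst C)) = clause_vars C - S C" if "C \<in> F" for C
    using drop_vars_disjoint[of "lst C" \<alpha>] lst[OF that] by (simp add: S_def clause_vars_def)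
  have "{c \<in> set (truncation \<alpha> cs). x \<in> cvars c}
      \<subseteq> (\<lambda>C. drop \<alpha> (lst C)) ` {C \<in> F. x \<in> clause_vars C - S C}"
  proof
    fix d assume "d \<in> {c \<in> set (truncation \<alpha> cs). x \<in> cvars c}"
    then obtain c where c: "c \<in> set cs" "d = drop \<alpha> (lst (set c))" "x \<in> cvars d"
      using lst_set by (auto simp: truncation_def)
    have "set c \<in> F" using lists_cnf_clause(1)[OF cs F' c(1)] .
    then show "d \<in> (\<lambda>C. drop \<alpha> (lst C)) ` {C \<in> F. x \<in> clause_vars C - S C}"
      using c drop[of "set c"] by (intro image_eqI[of _ _ "set c"]) (simp_all add: cvars_def)
  qed
  moreover have "finite {C \<in> F. x \<in> clause_vars C - S C}" using F' by (simp add: k_cnf_def)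
  ultimately have "card {c \<in> set (truncation \<alpha> cs). x \<in> cvars c}
      \<le> card {C \<in> F. x \<in> clause_vars C - S C}"
    by (rule surj_card_le[rotated])
  also have "real \<dots> \<le> bound_base k \<alpha>"
  proof (rule truncated_degree_le[OF pos F base])
    fix C assume C: "C \<in> F"
    have "distinct (map var (take \<alpha> (lst C)))"
      using lst[OF C] by (simp add: take_map[symmetric])
    then have "card (S C) = length (take \<alpha> (lst C))"
      unfolding S_def by (metis distinct_card length_map list.set_map)
    moreover have "S C \<subseteq> clause_vars C"
      using lst[OF C] set_take_subset[of \<alpha> "lst C"] by (auto simp: S_def clause_vars_def)
    ultimately show "S C \<subseteq> clause_vars C \<and> card (S C) = \<alpha>" using lst[OF C] \<alpha> by simp
    fix y z assume y: "y \<in> S C" and z: "z \<in> clause_vars C - S C"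
    obtain l where l: "l \<in> set (take \<alpha> (lst C))" "y = var l" using y by (auto simp: S_def)
    obtain l' where l': "l' \<in> set (drop \<alpha> (lst C))" "z = var l'"
      using z drop[OF C] by auto
    have "sorted (map (codegree_key cs) (take \<alpha> (lst C) @ drop \<alpha> (lst C)))"
      using lst[OF C] by simp
    then have "codegree cs y \<le> codegree cs z"
      using l l' unfolding map_append sorted_append by auto
    then show "card (occurrences F z) \<le> card (occurrences F y)"
      using codegree_occurrences[OF cs, of y] codegree_occurrences[OF cs, of z] by linarith
  qed
  finally show ?thesis by simp
qed

text \<open>
  \<open>k * (k * (m + n + 1))\<close> coins are needed, where the number \<open>m\<close> of clauses and \<open>k\<close> are at most the
  input size \<open>N\<close> and the number \<open>n\<close> of variables is at most \<open>N * N\<close>.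
\<close>

definition coins :: "nat \<Rightarrow> nat" where
  "coins N = N * N * (N + N * N + 1)"

lemma truncation_few_failures:
  assumes pos: "k > 0" "\<alpha> > 0" and F: "small_intersecting k \<alpha> F" and base: "bound_base k \<alpha> \<ge> 1"
    and cs: "lists_cnf cs F" "cs \<noteq> []"
  shows "2 * card {r. length r = coins (input_size cs) \<and> mt (truncation \<alpha> cs) s r = None}
    \<le> 2 ^ coins (input_size cs)"
proof -
  let ?D = "bound_base k \<alpha>" and ?N = "input_size cs" and ?t = "truncation \<alpha> cs"
  let ?V = "\<Union>c\<in>set ?t. cvars c"
  have F': "k_cnf k F" using F by (simp add: small_intersecting_def)
  have k: "\<alpha> + 2 \<le> k" by (rule bound_base_ge_1_imp[OF pos base])
  note clause = lists_cnf_clause[OF cs(1) F']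
  have pow: "2 powr (real k - real \<alpha>) = (2 :: real) ^ (k - \<alpha>)"
    using k by (subst powr_realpow[symmetric]) (simp_all add: of_nat_diff)
  have tr: "length c = k - \<alpha> \<and> distinct (map var c)" if "c \<in> set ?t" for c
  proof -
    from that obtain d where d: "d \<in> set cs" "c = drop \<alpha> (sort_key (codegree_key cs) d)"
      unfolding truncation_def by auto
    have "distinct (map var (sort_key (codegree_key cs) d))"
      using clause[OF d(1)] by (simp add: distinct_map)
    then show ?thesis using clause[OF d(1)] d(2) by (simp add: drop_map[symmetric])
  qed
  have kN: "k \<le> ?N" "length cs \<le> ?N"
    using short_cnf_input_size[of cs] clause(2) cs(2)
    unfolding short_cnf_def short_clause_def by (metis ex_in_conv set_empty)+
  have "card ?V \<le> (\<Sum>c\<in>set ?t. card (cvars c))" by (intro card_UN_le) simp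
  also have "\<dots> \<le> card (set ?t) * ?N"
  proof (rule sum_bounded_above[of "set ?t" _ ?N, simplified])
    fix c assume "c \<in> set ?t"
    then have "length c \<le> ?N" using tr kN by simp
    then show "card (cvars c) \<le> ?N"
      unfolding cvars_def by (meson card_image_le card_length finite_set order.trans)
  qed
  also have "card (set ?t) \<le> ?N"
    using card_length[of ?t] kN by (simp add: truncation_def)
  finally have V: "card ?V \<le> ?N * ?N" by (simp add: mult_le_mono1)
  have len: "length ?t = length cs" by (simp add: truncation_def)
  show ?thesis
  proof (rule few_mt_failures)
    show "\<forall>c\<in>set ?t. length c = k - \<alpha> \<and> distinct (map var c)" using tr by blast
    \<comment> \<open>A degree is an integer, so the real bound may be rounded down.\<close>
    show "card {c \<in> set ?t. x \<in> cvars c} \<le> nat \<lfloor>?D\<rfloor>" for x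
      using truncation_degree[OF pos F base cs(1), of x] by (simp add: le_nat_floor)
    have "real (nat \<lfloor>?D\<rfloor>) \<le> ?D" using base by simp
    then show "real (k - \<alpha>) * real (nat \<lfloor>?D\<rfloor>) \<le> real (k - \<alpha>) * ?D" by (intro mult_left_mono) auto
    have "2 * 1 \<le> real (k - \<alpha>) * ?D" using k base by (intro mult_mono) auto
    then show "2 \<le> real (k - \<alpha>) * ?D" by (simp only: mult_1_right)
    \<comment> \<open>\<open>e\<close> cancels. The clause length \<open>k - \<alpha>\<close> over
      the \<open>k\<close> in \<open>bound_base\<close> provides the slack with
      \<open>q = k\<close>, as \<open>\<alpha>\<close> \<ge> 1.\<close>
    have "exp 1 * (real (k - \<alpha>) * ?D) = 2 ^ (k - \<alpha>) * (real (k - \<alpha>) / real k)"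
      unfolding bound_base_def pow using pos by simp
    also have "real (k - \<alpha>) / real k \<le> 1 - 1 / real k"
      using k pos by (simp add: of_nat_diff field_simps)
    finally show "exp 1 * (real (k - \<alpha>) * ?D) \<le> 2 ^ (k - \<alpha>) * (1 - 1 / real k)"
      by (simp add: mult_left_mono)
    show "(k - \<alpha>) * (k * (length ?t + card ?V + 1)) \<le> coins ?N"
    proof -
      have "(k - \<alpha>) * (k * (length ?t + card ?V + 1)) \<le> ?N * (?N * (?N + ?N * ?N + 1))"
        using kN V len by (intro mult_le_mono) auto
      then show ?thesis unfolding coins_def by (simp only: mult.assoc)
    qed
  qed (use k pos in auto)
qed

lemma sat_drop: "sat a (drop j c) \<Longrightarrow> sat a c"
  unfolding sat_def by (meson in_set_dropD)

lemma try_tails_sound: "try_tails cs s r = Some s' \<Longrightarrow> \<forall>c\<in>set cs. sat (assignment_of s') c"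
proof (induction cs s r rule: try_tails.induct)
  case (1 cs s r)
  show ?case
  proof (cases "mt cs s r")
    case (Some s'')
    then show ?thesis using 1(2) mt_sound by (simp add: try_tails.simps[of cs s r])
  next
    case None
    show ?thesis
    proof (cases "cs = [] \<or> hd cs = []")
      case True
      then show ?thesis using None 1(2) by (simp add: try_tails.simps[of cs s r])
    next
      case False
      then have "try_tails (map tl cs) s r = Some s'"
        using None 1(2) by (simp add: try_tails.simps[of cs s r])
      from 1(1)[OF None False this] have "\<forall>c\<in>set cs. sat (assignment_of s') (tl c)" by simp
      then show ?thesis using sat_drop[of _ 1] by (simp add: drop_Suc)
    qed
  qed
qed

lemma mt_Nil [simp]: "mt [] s r = Some s"
  by (simp add: mt.simps[of "[]"] unsat_def)

text \<open>Before giving up, the loop passes every depth up to the clause length. Its failures are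
  thus among the failures for any single \<open>j\<close>.\<close>

lemma try_tails_None:
  assumes "try_tails cs s r = None" "\<forall>c\<in>set cs. j \<le> length c"
  shows "mt (map (drop j) cs) s r = None"
  using assms
proof (induction j arbitrary: cs)
  case 0
  then have "mt cs s r = None" by (simp add: try_tails.simps[of cs s r] split: option.splits)
  then show ?case by (simp add: drop_0[abs_def] map_idI)
next
  case (Suc j)
  have None: "mt cs s r = None"
    using Suc.prems(1) by (simp add: try_tails.simps[of cs s r] split: option.splits)
  then have "cs \<noteq> []" by auto
  moreover have "hd cs \<noteq> []" using Suc.prems(2) hd_in_set[OF \<open>cs \<noteq> []\<close>] by force
  ultimately have "try_tails (map tl cs) s r = None"
    using Suc.prems(1) None by (simp add: try_tails.simps[of cs s r])
  moreover have "\<forall>c\<in>set (map tl cs). j \<le> length c" using Suc.prems(2) by auto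
  ultimately have "mt (map (drop j) (map tl cs)) s r = None" by (rule Suc.IH)
  then show ?case by (simp add: drop_Suc o_def)
qed

definition sorted_clauses :: "literal list list \<Rightarrow> literal list list" where
  "sorted_clauses cs = map (sort_key (codegree_key cs)) cs"

lemma sat_sorted_clauses:
  "(\<forall>c\<in>set (sorted_clauses cs). sat a c) \<longleftrightarrow> (\<forall>c\<in>set cs. sat a c)"
  by (auto simp: sorted_clauses_def sat_def)

lemma no_pairs_isolated:
  assumes "intersection_pairs F = {}" "C \<in> F"
  shows "isolated F C"
  using assms by (fastforce simp: isolated_def intersection_pairs_def)

text \<open>In one case the truncation by \<open>\<alpha>\<close> bounds the failures. In the other
  the starting list already satisfies every clause, and no coin string fails.\<close>

lemma few_failures:
  assumes pos: "k > 0" "\<alpha> > 0" and F: "small_intersecting k \<alpha> F" and cs: "lists_cnf cs F"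
  shows "2 * card {r. length r = coins (input_size cs)
      \<and> try_tails (sorted_clauses cs) (initial cs) r = None} \<le> 2 ^ coins (input_size cs)"
    (is "2 * card ?R \<le> _")
\<comment> \<open>The empty formula goes to the second case: without a clause, the input size does
  not bound \<open>k\<close>.\<close>
proof (cases "bound_base k \<alpha> \<ge> 1 \<and> cs \<noteq> []")
  case True
  have F': "k_cnf k F" using F by (simp add: small_intersecting_def)
  have "?R \<subseteq> {r. length r = coins (input_size cs) \<and> mt (truncation \<alpha> cs) (initial cs) r = None}"
  proof
    fix r assume r: "r \<in> ?R"
    have "\<forall>c\<in>set (sorted_clauses cs). \<alpha> \<le> length c"
      using lists_cnf_clause(2)[OF cs F'] bound_base_ge_1_imp[OF pos] True
      by (auto simp: sorted_clauses_def)
    with r have "mt (map (drop \<alpha>) (sorted_clauses cs)) (initial cs) r = None"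
      by (intro try_tails_None) auto
    with r show "r \<in> {r. length r = coins (input_size cs)
        \<and> mt (truncation \<alpha> cs) (initial cs) r = None}"
      by (simp add: sorted_clauses_def truncation_def o_def)
  qed
  then have "card ?R \<le> card {r. length r = coins (input_size cs)
      \<and> mt (truncation \<alpha> cs) (initial cs) r = None}"
    by (intro card_mono finite_subset[OF _ finite_bool_lists[of "coins (input_size cs)"]]) auto
  also have "2 * \<dots> \<le> 2 ^ coins (input_size cs)"
    using True by (intro truncation_few_failures[OF pos F _ cs]) auto
  finally show ?thesis by simp
next
  case False
  have F': "k_cnf k F" using F by (simp add: small_intersecting_def)
  have "sat (assignment_of (initial cs)) c" if c: "c \<in> set cs" for c
  proof (rule initial_sat_isolated[OF cs F' pos(1) c])
    have "bound_base k \<alpha> < 1" using False c by auto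
    then show "isolated F (set c)"
      using no_intersection_if_bound_base_less_1[OF pos F] no_pairs_isolated
        lists_cnf_clause(1)[OF cs F' c] by blast
  qed
  then have "\<forall>c\<in>set (sorted_clauses cs). sat (assignment_of (initial cs)) c"
    by (simp add: sat_sorted_clauses)
  then have "unsat (sorted_clauses cs) (initial cs) = []" by (simp add: unsat_Nil)
  then have "try_tails (sorted_clauses cs) (initial cs) r = Some (initial cs)" for r
    by (simp add: try_tails.simps[of "sorted_clauses cs"] mt.simps[of "sorted_clauses cs"])
  then show ?thesis by simp
qed

text \<open>At most half of the coin strings fail and there is at least one string, so some string
  leads to an assignment.\<close>

theorem small_intersecting_satisfiable:
  assumes "k > 0" "\<alpha> > 0" "small_intersecting k \<alpha> F"
  shows "satisfiable F"
proof -
  have "finite F" "\<forall>C\<in>F. finite C" using assms(3) by (auto simp: small_intersecting_def k_cnf_def)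
  then obtain cs where cs: "lists_cnf cs F" using lists_cnf_exists by blast
  let ?L = "coins (input_size cs)"
  let ?R = "{r. length r = ?L \<and> try_tails (sorted_clauses cs) (initial cs) r = None}"
  have "2 * card ?R \<le> 2 ^ ?L" by (rule few_failures[OF assms cs])
  moreover have "(0 :: nat) < 2 ^ ?L" by simp
  ultimately have "card ?R \<noteq> 2 ^ ?L" by linarith
  then have "?R \<noteq> {r. length r = ?L}" using card_bool_lists[of ?L] by metis
  then obtain r where "try_tails (sorted_clauses cs) (initial cs) r \<noteq> None" by blast
  then obtain s where "try_tails (sorted_clauses cs) (initial cs) r = Some s" by blast
  then have "\<forall>c\<in>set cs. sat (assignment_of s) c"
    using try_tails_sound sat_sorted_clauses by blast
  then show ?thesis using satisfies_lists[OF cs] by (auto simp: satisfiable_def)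
qed

section \<open>Local search\<close>

lemma first_some_None: "first_some g xs = None \<longleftrightarrow> (\<forall>x\<in>set xs. g x = None)"
  by (induction xs) (auto split: option.splits)

lemma first_some_Some: "first_some g xs = Some y \<Longrightarrow> \<exists>x\<in>set xs. g x = Some y"
  by (induction xs) (auto split: option.splits)

lemma search_sound: "search cs d s = Some s' \<Longrightarrow> \<forall>c\<in>set cs. sat (assignment_of s') c"
proof (induction d arbitrary: s)
  case 0
  then show ?case
    using unsat_Nil[of cs s] by (cases "unsat cs s") auto
next
  case (Suc d)
  show ?case
  proof (cases "unsat cs s")
    case Nil
    then show ?thesis using Suc.prems unsat_Nil[of cs s] by auto
  next
    case (Cons c ds)
    with Suc.prems have "first_some (\<lambda>l. search cs d (assign (var l) (positive l) s)) c = Some s'"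
      by simp
    from first_some_Some[OF this] show ?thesis using Suc.IH by blast
  qed
qed

text \<open>A violated clause contains a literal that holds under \<open>b\<close>, and making it
  true brings the assignment one step closer to \<open>b\<close> in Hamming distance. This literal
  is among those tried.\<close>

lemma search_complete:
  assumes b: "\<forall>c\<in>set cs. sat b c"
    and "finite {x. b x \<noteq> assignment_of s x}" "card {x. b x \<noteq> assignment_of s x} \<le> d"
  shows "search cs d s \<noteq> None"
  using assms(2,3)
proof (induction d arbitrary: s)
  case 0
  then have "b = assignment_of s" by auto
  then have "unsat cs s = []" using b by (simp add: unsat_Nil)
  then show ?case by simp
next
  case (Suc d)
  show ?case
  proof (cases "unsat cs s")
    case Nil
    then show ?thesis by simp
  next
    case (Cons c ds)
    from unsat_Cons[OF Cons] have c: "c \<in> set cs" "\<not> sat (assignment_of s) c"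
      by (auto simp: find_Some_iff)
    then obtain l where l: "l \<in> set c" "b (var l) = positive l" "assignment_of s (var l) \<noteq> positive l"
      using b unfolding sat_def lit_holds_iff by blast
    let ?s = "assign (var l) (positive l) s"
    have diff: "{x. b x \<noteq> assignment_of ?s x} = {x. b x \<noteq> assignment_of s x} - {var l}"
      using l by (auto simp: assignment_of_assign)
    have "var l \<in> {x. b x \<noteq> assignment_of s x}" using l by auto
    then have "card {x. b x \<noteq> assignment_of ?s x} < card {x. b x \<noteq> assignment_of s x}"
      unfolding diff using Suc.prems(1) by (intro card_Diff1_less)
    then have "card {x. b x \<noteq> assignment_of ?s x} \<le> d" using Suc.prems(2) by linarith
    moreover have "finite {x. b x \<noteq> assignment_of ?s x}"
      unfolding diff using Suc.prems(1) by (rule finite_Diff)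
    ultimately have "search cs d ?s \<noteq> None" by (intro Suc.IH)
    then show ?thesis using l(1) Cons by (auto simp: first_some_None)
  qed
qed

text \<open>The sum covers the three cases of \<^const>\<open>small_intersecting\<close> at once, as all three bounds are
  nonnegative.\<close>

definition depth_bound :: "nat \<Rightarrow> nat \<Rightarrow> nat" where
  "depth_bound k \<alpha> = nat \<lceil>2 * real k * L_i k \<alpha> + L_n k \<alpha> + real k * L_m k \<alpha>\<rceil>"

lemma card_vars_le:
  assumes "k_cnf k F" "G \<subseteq> F"
  shows "card (vars G) \<le> k * card G"
proof -
  have "finite G" using assms by (auto simp: k_cnf_def intro: finite_subset)
  then have "card (vars G) \<le> (\<Sum>C\<in>G. card (clause_vars C))" unfolding vars_def by (rule card_UN_le)
  also have "\<dots> = (\<Sum>C\<in>G. k)" using k_cnf_clause_vars[OF assms(1)] assms(2) by (intro sum.cong) auto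
  finally show ?thesis by (simp add: mult.commute)
qed

text \<open>A clause that is not isolated lies in some intersection pair, and a pair covers two
  clauses.\<close>

lemma card_nonisolated_le:
  assumes "finite F"
  shows "card {C \<in> F. \<not> isolated F C} \<le> 2 * card (intersection_pairs F)"
proof -
  have "{C \<in> F. \<not> isolated F C} \<subseteq> (\<Union>p\<in>intersection_pairs F. p)"
  proof
    fix C assume "C \<in> {C \<in> F. \<not> isolated F C}"
    then obtain D where "C \<in> F" "D \<in> F" "C \<noteq> D" "clause_vars C \<inter> clause_vars D \<noteq> {}"
      unfolding isolated_def by blast
    then have "{C, D} \<in> intersection_pairs F" unfolding intersection_pairs_def by blast
    then show "C \<in> (\<Union>p\<in>intersection_pairs F. p)" by blast
  qed
  moreover have "finite (\<Union>p\<in>intersection_pairs F. p)"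
    by (rule finite_subset[OF _ assms]) (auto simp: intersection_pairs_def)
  ultimately have "card {C \<in> F. \<not> isolated F C} \<le> card (\<Union>p\<in>intersection_pairs F. p)"
    by (rule card_mono[rotated])
  also have "\<dots> \<le> (\<Sum>p\<in>intersection_pairs F. card p)"
    by (rule card_UN_le[OF finite_intersection_pairs[OF assms]])
  also have "\<dots> = (\<Sum>p\<in>intersection_pairs F. 2)"
    unfolding intersection_pairs_def by (intro sum.cong refl) (auto simp only: mem_Collect_eq card_2_iff)
  finally show ?thesis by simp
qed

text \<open>This makes the search depth a constant for fixed \<open>k\<close> and
  \<open>\<alpha>\<close>. A bound on clauses becomes one on variables by a factor \<open>k\<close>,
  a bound on pairs by a factor \<open>2 * k\<close>.\<close>

lemma card_nonisolated_vars:
  assumes pos: "k > 0" "\<alpha> > 0" and F: "small_intersecting k \<alpha> F"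
  shows "card (vars {C \<in> F. \<not> isolated F C}) \<le> depth_bound k \<alpha>"
proof -
  let ?G = "{C \<in> F. \<not> isolated F C}"
  have F': "k_cnf k F" using F by (simp add: small_intersecting_def)
  then have fin: "finite F" by (simp add: k_cnf_def)
  have nonneg: "0 \<le> L_i k \<alpha>" "0 \<le> L_n k \<alpha>" "0 \<le> L_m k \<alpha>"
    by (simp_all add: L_i_def L_n_def L_m_def)
  have G: "real (card (vars ?G)) \<le> real (k * card ?G)"
    by (rule of_nat_mono[OF card_vars_le[OF F']]) auto
  have products: "0 \<le> 2 * real k * L_i k \<alpha>" "0 \<le> real k * L_m k \<alpha>" using nonneg by simp_all
  from F consider
      "real (card (intersection_pairs F)) < L_i k \<alpha>"
    | "real (card (vars F)) < L_n k \<alpha>"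
    | "real (card F) < L_m k \<alpha>"
    by (auto simp: small_intersecting_def)
  then have "real (card (vars ?G)) \<le> 2 * real k * L_i k \<alpha> + L_n k \<alpha> + real k * L_m k \<alpha>"
  proof cases
    case 1
    have "real (card ?G) \<le> 2 * real (card (intersection_pairs F))"
      using card_nonisolated_le[OF fin] by linarith
    also have "\<dots> \<le> 2 * L_i k \<alpha>" using 1 by simp
    finally have "real k * real (card ?G) \<le> real k * (2 * L_i k \<alpha>)" by (intro mult_left_mono) auto
    also have "\<dots> = 2 * real k * L_i k \<alpha>" by simp
    finally show ?thesis using G nonneg products unfolding of_nat_mult by linarith
  next
    case 2
    have "card (vars ?G) \<le> card (vars F)"
      using finite_vars[OF F'] by (intro card_mono) (auto simp: vars_def)
    then show ?thesis using 2 products by linarith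
  next
    case 3
    have "card ?G \<le> card F" using fin by (intro card_mono) auto
    then have "real k * real (card ?G) \<le> real k * L_m k \<alpha>" using 3 by (intro mult_left_mono) auto
    then show ?thesis using G nonneg products unfolding of_nat_mult by linarith
  qed
  then show ?thesis unfolding depth_bound_def by linarith
qed

text \<open>Changes to variables of non-isolated clauses therefore leave the isolated clauses as
  they were.\<close>

lemma isolated_vars:
  assumes "isolated F C" "C \<in> F" "x \<in> clause_vars C"
  shows "x \<notin> vars {D \<in> F. \<not> isolated F D}"
proof
  assume "x \<in> vars {D \<in> F. \<not> isolated F D}"
  then obtain D where D: "D \<in> F" "\<not> isolated F D" "x \<in> clause_vars D" by (auto simp: vars_def)
  have "D \<noteq> C" using D(2) assms(1) by blast
  then have "clause_vars C \<inter> clause_vars D = {}"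
    using assms(1) D(1) unfolding isolated_def[of F C] by blast
  then show False using assms(3) D(3) by blast
qed

lemma search_from_initial:
  assumes pos: "k > 0" "\<alpha> > 0" and F: "small_intersecting k \<alpha> F" and cs: "lists_cnf cs F"
  shows "search cs (depth_bound k \<alpha>) (initial cs) \<noteq> None"
proof -
  let ?W = "vars {C \<in> F. \<not> isolated F C}"
  have F': "k_cnf k F" using F by (simp add: small_intersecting_def)
  obtain a where a: "satisfies a F"
    using small_intersecting_satisfiable[OF assms(1-3)] by (auto simp: satisfiable_def)
  \<comment> \<open>Glues an arbitrary satisfying assignment on \<open>?W\<close> to the initial one
    elsewhere; the two differ in at most \<open>card ?W\<close> places from the point of view of the
    search, which starts at the initial one.\<close>
  define b where "b = (\<lambda>x. if x \<in> ?W then a x else assignment_of (initial cs) x)"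
  have fin: "finite ?W"
    by (rule finite_subset[OF _ finite_vars[OF F']]) (auto simp: vars_def)
  have sub: "{x. b x \<noteq> assignment_of (initial cs) x} \<subseteq> ?W" by (auto simp: b_def)
  show ?thesis
  proof (rule search_complete)
    show "finite {x. b x \<noteq> assignment_of (initial cs) x}" using sub fin by (rule finite_subset)
    have "card {x. b x \<noteq> assignment_of (initial cs) x} \<le> card ?W" using fin sub by (rule card_mono)
    then show "card {x. b x \<noteq> assignment_of (initial cs) x} \<le> depth_bound k \<alpha>"
      using card_nonisolated_vars[OF pos F] by linarith
    show "\<forall>c\<in>set cs. sat b c"
    proof
      fix c assume c: "c \<in> set cs"
      note C = lists_cnf_clause(1)[OF cs F' c]
      have cong: "sat b c = sat e c" if "\<And>x. x \<in> clause_vars (set c) \<Longrightarrow> b x = e x" for e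
        unfolding sat_def using that
        by (intro bex_cong refl lit_holds_cong) (simp add: clause_vars_def)
      show "sat b c"
      proof (cases "isolated F (set c)")
        case True
        have "x \<notin> ?W" if "x \<in> clause_vars (set c)" for x
          by (rule isolated_vars[OF True C that])
        then have "sat b c = sat (assignment_of (initial cs)) c" by (intro cong) (simp add: b_def)
        then show ?thesis using initial_sat_isolated[OF cs F' pos(1) c True] by simp
      next
        case False
        with C have "clause_vars (set c) \<subseteq> ?W" unfolding vars_def by blast
        then have "x \<in> ?W" if "x \<in> clause_vars (set c)" for x using that by (rule subsetD)
        then have "sat b c = sat a c" by (intro cong) (simp add: b_def)
        then show ?thesis using a c satisfies_lists[OF cs] by simp
      qed
    qed
  qed
qed

section \<open>Polynomial running times\<close>

definition poly_fun :: "(nat \<Rightarrow> nat) \<Rightarrow> bool" where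
  "poly_fun f \<longleftrightarrow> (\<exists>p. \<forall>n. poly p n = f n)"

lemma poly_fun_const: "poly_fun (\<lambda>n. c)"
  unfolding poly_fun_def by (intro exI[of _ "[:c:]"]) simp

lemma poly_fun_id: "poly_fun (\<lambda>n. n)"
  unfolding poly_fun_def by (intro exI[of _ "[:0, 1:]"]) simp

lemma poly_fun_add: "poly_fun f \<Longrightarrow> poly_fun g \<Longrightarrow> poly_fun (\<lambda>n. f n + g n)"
  unfolding poly_fun_def by (metis poly_add)

lemma poly_fun_mult: "poly_fun f \<Longrightarrow> poly_fun g \<Longrightarrow> poly_fun (\<lambda>n. f n * g n)"
  unfolding poly_fun_def by (metis poly_mult)

lemmas poly_fun_intros = poly_fun_id poly_fun_const poly_fun_add poly_fun_mult

lemma poly_fun_t_unsat: "poly_fun S \<Longrightarrow> poly_fun (\<lambda>n. t_unsat n (S n))"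
  unfolding t_unsat_def t_sat_def t_mem_def by (intro poly_fun_intros)

lemma poly_fun_t_search: "poly_fun S \<Longrightarrow> poly_fun (\<lambda>n. t_search k n (S n) d)"
proof (induction d)
  case 0
  then show ?case unfolding t_search.simps by (intro poly_fun_intros poly_fun_t_unsat)
next
  case (Suc d)
  then show ?case
    unfolding t_search.simps t_mem_def by (intro poly_fun_intros poly_fun_t_unsat) simp_all
qed

lemma poly_fun_t_try:
  "poly_fun S \<Longrightarrow> poly_fun R \<Longrightarrow> poly_fun (\<lambda>n. t_try n (S n) (R n))"
  unfolding t_try_def t_step_def t_resample_def t_mem_def
  by (intro poly_fun_intros poly_fun_t_unsat)

lemma poly_fun_t_sortall: "poly_fun t_sortall"
  unfolding t_sortall_def t_sort_def t_ins_def t_codeg_def t_occ_def by (intro poly_fun_intros)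

lemma poly_fun_t_init: "poly_fun t_init"
  unfolding t_init_def t_mem_def by (intro poly_fun_intros)

lemma poly_fun_coins: "poly_fun coins"
  unfolding coins_def by (intro poly_fun_intros)

text \<open>The search depth depends only on \<open>k\<close> and \<open>\<alpha>\<close>, so it is
  written into the program as a constant expression.\<close>

primrec unaryE :: "nat \<Rightarrow> expr" where
  "unaryE 0 = AtomE"
| "unaryE (Suc n) = CellE AtomE (unaryE n)"

lemma res_unaryE: "res P \<rho> (unaryE n) = Some (unary n, 2 * n + 1)"
  by (induction n) simp_all

text \<open>\<open>RightE\<close> strips the success tag without a test, as the search cannot fail
  on the formulas considered.\<close>

definition search_main :: "nat \<Rightarrow> expr" where
  "search_main d = RightE (CallE f_search [V0, CallE f_init [V0], unaryE d])"

definition try_main :: expr where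
  "try_main = CallE f_try [CallE f_sortall [V0, V0], CallE f_init [V0], V1]"

definition t_search_main :: "nat \<Rightarrow> nat \<Rightarrow> nat \<Rightarrow> nat" where
  "t_search_main k d N = t_search k N (N + d) d + t_init N + 2 * d + 100"

text \<open>The initial list has at most \<open>N\<close> entries, and each of the
  \<open>coins N\<close> coins accounts for at most \<open>N\<close> more. At most
  \<open>N + 1\<close> truncations are tried.\<close>

definition t_try_main :: "nat \<Rightarrow> nat" where
  "t_try_main N = (N + 1) * t_try N (N + N * coins N) (coins N) + t_sortall N + t_init N + 100"

lemma run_search_main:
  assumes cs: "\<forall>c\<in>set cs. length c = k" "k > 0" and s: "search cs d (initial cs) = Some s"
  shows "gives (res (search_main d # lib) [enc_cnf cs] (search_main d)) (enc_var_list s)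
    (t_search_main k d (input_size cs))"
proof -
  let ?N = "input_size cs"
  note short = short_cnf_input_size[of cs]
  have "\<forall>c\<in>set cs. c \<noteq> []" using cs by force
  then obtain t1 where t1: "call (search_main d # lib) f_init [enc_cnf cs]
      = Some (enc_var_list (initial cs), t1)" "t1 \<le> t_init ?N"
    by (rule givesE[OF call_init[OF short]])
  have "length (initial cs) + d \<le> ?N + d"
    using length_initial[of cs] short by (simp add: short_cnf_def)
  moreover have "\<forall>c\<in>set cs. length c \<le> k" using cs by simp
  ultimately obtain t2 where t2: "call (search_main d # lib) f_search
      [enc_cnf cs, enc_var_list (initial cs), unary d] = Some (enc_result (Some s), t2)"
      "t2 \<le> t_search k ?N (?N + d) d"
    using s call_search[OF short, of k "initial cs" d "?N + d" "search_main d"]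
    by (auto simp: gives_def)
  show ?thesis
    \<comment> \<open>Unfolds the main expression only where it is evaluated. Inside the program it
      has to stay folded, so that the facts about calls still match.\<close>
    using t1 t2 unfolding search_main_def[of d, THEN arg_cong, of "res (search_main d # lib) [enc_cnf cs]"]
    by (simp add: gives_def res_unaryE t_search_main_def)
qed

lemma run_try_main:
  assumes cs: "\<forall>c\<in>set cs. length c = k" "k > 0" and r: "length r = coins (input_size cs)"
  shows "gives (res (try_main # lib) [enc_cnf cs, enc_list enc_bool r] try_main)
    (enc_result (try_tails (sorted_clauses cs) (initial cs) r)) (t_try_main (input_size cs))"
proof -
  let ?N = "input_size cs"
  note short = short_cnf_input_size[of cs]
  have "\<forall>c\<in>set cs. c \<noteq> []" using cs by force
  then obtain t1 where t1: "call (try_main # lib) f_init [enc_cnf cs]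
      = Some (enc_var_list (initial cs), t1)" "t1 \<le> t_init ?N"
    by (rule givesE[OF call_init[OF short]])
  obtain t2 where t2: "call (try_main # lib) f_sortall [enc_cnf cs, enc_cnf cs]
      = Some (enc_cnf (sorted_clauses cs), t2)" "t2 \<le> t_sortall ?N"
    unfolding sorted_clauses_def by (rule givesE[OF call_sortall[OF short short]])
  have short': "short_cnf ?N (sorted_clauses cs)"
    using short short_clause_sort by (auto simp: short_cnf_def sorted_clauses_def)
  have "length (initial cs) + ?N * length r \<le> ?N + ?N * coins ?N"
    using length_initial[of cs] short r by (simp add: short_cnf_def)
  then obtain t3 where t3: "call (try_main # lib) f_try
      [enc_cnf (sorted_clauses cs), enc_var_list (initial cs), enc_list enc_bool r]
      = Some (enc_result (try_tails (sorted_clauses cs) (initial cs) r), t3)"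
      "t3 \<le> (width (sorted_clauses cs) + 1) * t_try ?N (?N + ?N * coins ?N) (length r)"
    by (rule givesE[OF call_try[OF short']])
  have "width (sorted_clauses cs) \<le> ?N"
  proof (cases "sorted_clauses cs")
    case (Cons c ds)
    then show ?thesis using short' by (simp add: width_def short_cnf_def short_clause_def)
  qed (simp add: width_def)
  then have "(width (sorted_clauses cs) + 1) * t_try ?N (?N + ?N * coins ?N) (length r)
      \<le> (?N + 1) * t_try ?N (?N + ?N * coins ?N) (coins ?N)"
    unfolding r by (intro mult_le_mono1) simp
  with t3(2) have t3': "t3 \<le> (?N + 1) * t_try ?N (?N + ?N * coins ?N) (coins ?N)" by linarith
  have "t1 + t2 + t3 + 100 \<le> t_try_main ?N"
    unfolding t_try_main_def using t1(2) t2(2) t3' by linarith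
  then show ?thesis
    using t1(1) t2(1) t3(1)
    unfolding try_main_def[THEN arg_cong, of "res (try_main # lib) [enc_cnf cs, enc_list enc_bool r]"]
    by (simp add: gives_def)
qed

lemma runs_iff: "runs (e # P) ins out t \<longleftrightarrow> res (e # P) ins e = Some (out, t)"
  by (simp add: runs_def res_iff)

lemma poly_time_search:
  assumes pos: "k > 0" "\<alpha> > 0"
  shows "poly_time_satisfying {F. small_intersecting k \<alpha> F}"
proof -
  let ?d = "depth_bound k \<alpha>"
  have "poly_fun (t_search_main k ?d)"
    unfolding t_search_main_def
    by (intro poly_fun_intros poly_fun_t_search poly_fun_t_init)
  then obtain p where p: "\<And>n. poly p n = t_search_main k ?d n" by (auto simp: poly_fun_def)
  show ?thesis
    unfolding poly_time_satisfying_def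
  proof (intro exI[of _ "search_main ?d # lib"] exI[of _ p] ballI allI impI)
    fix F cs assume "F \<in> {F. small_intersecting k \<alpha> F}" and cs: "lists_cnf cs F"
    then have F: "small_intersecting k \<alpha> F" by simp
    then have F': "k_cnf k F" by (simp add: small_intersecting_def)
    obtain s where s: "search cs ?d (initial cs) = Some s"
      using search_from_initial[OF pos F cs] by auto
    have "\<forall>c\<in>set cs. length c = k" using lists_cnf_clause(2)[OF cs F'] by blast
    from run_search_main[OF this pos(1) s]
    obtain t where t: "res (search_main ?d # lib) [enc_cnf cs] (search_main ?d) = Some (enc_var_list s, t)"
        "t \<le> t_search_main k ?d (input_size cs)"
      by (rule givesE)
    have "satisfies (assignment_of s) F"
      using search_sound[OF s] satisfies_lists[OF cs] by simp
    with t show "\<exists>xs t. runs (search_main ?d # lib) [enc_cnf cs] (enc_var_list xs) t \<and>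
        t \<le> poly p (input_size cs) \<and> satisfies (assignment_of xs) F"
      unfolding p runs_iff by blast
  qed
qed

text \<open>The program and both polynomials are fixed before \<open>k\<close> and
  \<open>\<alpha>\<close> are obtained from \<open>F\<close>; these two enter the analysis
  alone.\<close>

lemma rand_poly_time_try:
  "rand_poly_time_satisfying {F. \<exists>k \<alpha>. k > 0 \<and> \<alpha> > 0 \<and> small_intersecting k \<alpha> F}"
proof -
  obtain q where q: "\<And>n. poly q n = coins n" using poly_fun_coins by (auto simp: poly_fun_def)
  have "poly_fun t_try_main"
    unfolding t_try_main_def
    by (intro poly_fun_intros poly_fun_t_try poly_fun_t_sortall poly_fun_t_init poly_fun_coins)
  then obtain p where p: "\<And>n. poly p n = t_try_main n" by (auto simp: poly_fun_def)
  show ?thesis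
    unfolding rand_poly_time_satisfying_def Let_def
  proof (rule exI[of _ "try_main # lib"], rule exI[of _ p], rule exI[of _ q], intro ballI allI impI)
    fix F cs
    assume "F \<in> {F. \<exists>k \<alpha>. k > 0 \<and> \<alpha> > 0 \<and> small_intersecting k \<alpha> F}" and cs: "lists_cnf cs F"
    then obtain k \<alpha> where F: "k > 0" "\<alpha> > 0" "small_intersecting k \<alpha> F" by blast
    then have F': "k_cnf k F" by (simp add: small_intersecting_def)
    let ?L = "coins (input_size cs)"
    let ?R = "{r :: bool list. length r = ?L}"
    let ?run = "\<lambda>r. runs (try_main # lib) [enc_cnf cs, enc_list enc_bool r]"
    let ?out = "\<lambda>r. try_tails (sorted_clauses cs) (initial cs) r"
    have "\<forall>c\<in>set cs. length c = k" using lists_cnf_clause(2)[OF cs F'] by blast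
    note run = run_try_main[OF this F(1)]
    have total: "\<exists>t. ?run r (enc_result (?out r)) t \<and> t \<le> t_try_main (input_size cs)"
      if "r \<in> ?R" for r
      using run[of r] that unfolding runs_iff gives_def by auto
    \<comment> \<open>Runs are deterministic, and this run also returns the encoded result of
      \<open>try_tails\<close>; so an atom as output means that \<open>try_tails\<close>
      failed.\<close>
    have fail: "?out r = None" if "r \<in> ?R" "?run r Atom t" for r t
    proof -
      note fails = that
      obtain t' where "?run r (enc_result (?out r)) t'" using total[OF fails(1)] by blast
      with fails(2) have "enc_result (?out r) = Atom" unfolding runs_iff by simp
      then show ?thesis by (cases "?out r") simp_all
    qed
    have "{r \<in> ?R. \<exists>t. ?run r Atom t} \<subseteq> {r. length r = ?L \<and> ?out r = None}"
      using fail by blast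
    then have "card {r \<in> ?R. \<exists>t. ?run r Atom t} \<le> card {r. length r = ?L \<and> ?out r = None}"
      by (intro card_mono finite_subset[OF _ finite_bool_lists[of ?L]]) auto
    then have "2 * card {r \<in> ?R. \<exists>t. ?run r Atom t} \<le> card ?R"
      using few_failures[OF F cs] unfolding card_bool_lists by linarith
    moreover have "\<forall>r\<in>?R. \<exists>out t. ?run r out t \<and> t \<le> t_try_main (input_size cs) \<and>
        (out = Atom \<or> (\<exists>xs. out = Cell Atom (enc_var_list xs) \<and> satisfies (assignment_of xs) F))"
    proof
      fix r assume "r \<in> ?R"
      from total[OF this] obtain t
        where t: "?run r (enc_result (?out r)) t" "t \<le> t_try_main (input_size cs)" by blast
      have "enc_result (?out r) = Atom \<or> (\<exists>xs. enc_result (?out r) = Cell Atom (enc_var_list xs)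
          \<and> satisfies (assignment_of xs) F)"
      proof (cases "?out r")
        case (Some s)
        then have "satisfies (assignment_of s) F"
          using try_tails_sound[OF Some] sat_sorted_clauses satisfies_lists[OF cs] by simp
        with Some show ?thesis by auto
      qed simp
      with t show "\<exists>out t. ?run r out t \<and> t \<le> t_try_main (input_size cs) \<and>
          (out = Atom \<or> (\<exists>xs. out = Cell Atom (enc_var_list xs) \<and> satisfies (assignment_of xs) F))"
        by blast
    qed
    ultimately show "(\<forall>r\<in>{r. length r = poly q (input_size cs)}.
          \<exists>out t. ?run r out t \<and> t \<le> poly p (input_size cs) \<and>
            (out = Atom \<or> (\<exists>xs. out = Cell Atom (enc_var_list xs) \<and> satisfies (assignment_of xs) F))) \<and>
        2 * card {r \<in> {r. length r = poly q (input_size cs)}. \<exists>t. ?run r Atom t}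
          \<le> card {r :: bool list. length r = poly q (input_size cs)}"
      unfolding p q by blast
  qed
qed

theorem theorem2:
  shows "(\<forall>k \<alpha> F. k > 0 \<longrightarrow> \<alpha> > 0 \<longrightarrow> small_intersecting k \<alpha> F \<longrightarrow> satisfiable F) \<and>
         (\<forall>k \<alpha>. k > 0 \<longrightarrow> \<alpha> > 0 \<longrightarrow> poly_time_satisfying {F. small_intersecting k \<alpha> F}) \<and>
         rand_poly_time_satisfying {F. \<exists>k \<alpha>. k > 0 \<and> \<alpha> > 0 \<and> small_intersecting k \<alpha> F}"
  using small_intersecting_satisfiable poly_time_search rand_poly_time_try by blast

end
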